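(* Fix an integer $\ell\ge1$ and let $0\le b\le\lfloor \ell/2\rfloor$. Then $$T_{(\ell-b,b)}(z,q)=T_{(b,\ell-b)}(z,q)$$ $$=\sum_{n_1,\dots,n_\ell\ge0}\frac{z^{N_1}\,q^{\frac12(N_1^2+\cdots+N_\ell^2)+\frac12(n_1+n_3+\cdots+n_{2b-1})+\frac12(N_{2b+1}+N_{2b+2}+\cdots+N_\ell)}\,(q)_{N_1}}{(zq;q)_{N_1}(q)_{n_1}\cdots(q)_{n_\ell}}$$ $$=\sum_{N_1,\dots,N_\ell\ge0}\frac{z^{N_1}\,q^{\sum_{i=1}^{\ell}\binom{N_i+1}{2}-\sum_{i=1}^{b}N_{2i}}\,(q)_{N_1}}{(zq;q)_{N_1}(q)_{N_1-N_2}\cdots(q)_{N_{\ell-1}-N_\ell}(q)_{N_\ell}},$$ where in the first sum $N_j=n_j+n_{j+1}+\cdots+n_\ell$ for $1\le j\le \ell$.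
   Context: A partition is a weakly decreasing finite sequence of positive integers (its parts), extended by zeros beyond its last part. For $(c_1,c_2)\in\mathbb{Z}_{\ge0}^2$, a ($2$-rowed) cylindric partition of profile $(c_1,c_2)$ is a pair of (possibly empty) partitions $\pi=(\pi^{(1)},\pi^{(2)})$ such that $\pi^{(1)}_j\ge\pi^{(2)}_{j+c_2}$ and $\pi^{(2)}_j\ge\pi^{(1)}_{j+c_1}$ for all $j\ge1$. It is tight if no positive integer occurs as a part of both $\pi^{(1)}$ and $\pi^{(2)}$. Let $\mathscr{T}_{(c_1,c_2)}$ be the set of tight cylindric partitions of profile $(c_1,c_2)$. Let $\max(\pi)$ be the largest part occurring in $\pi$ ($0$ if both rows are empty) and $\mathrm{wt}(\pi)$ the sum of all parts of both rows. Define $T_{(c_1,c_2)}(z,q)=\sum_{\pi\in\mathscr{T}_{(c_1,c_2)}}z^{\max(\pi)}q^{\mathrm{wt}(\pi)}$, a formal power series in $z,q$. Notation: $(x;q)_n=\prod_{k=0}^{n-1}(1-xq^k)$ for $n\ge0$ and $(q)_n=(q;q)_n$; by the usual convention $1/(q)_n=0$ for $n<0$, so only terms with $N_1\ge N_2\ge\cdots\ge N_\ell\geq 0$ contribute to the second sum. For $b=0$ the sums $n_1+n_3+\cdots+n_{2b-1}$ and $\sum_{i=1}^b N_{2i}$ are empty, and for $2b=\ell$ the sum $N_{2b+1}+\cdots+N_\ell$ is empty. *)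

theory Defs
  imports
    "HOL-Analysis.Infinite_Sum"
    "HOL-Computational_Algebra.Formal_Power_Series"
begin

definition is_partition :: "nat list \<Rightarrow> bool" where
  "is_partition xs \<longleftrightarrow> sorted_wrt (\<ge>) xs \<and> (\<forall>x\<in>set xs. x > 0)"

text \<open>Parts are numbered from 1; the value at index 0 is never used.\<close>

definition part :: "nat list \<Rightarrow> nat \<Rightarrow> nat" where
  "part xs j = (if 1 \<le> j \<and> j \<le> length xs then xs ! (j - 1) else 0)"

definition cylindric_partition :: "nat \<Rightarrow> nat \<Rightarrow> nat list \<times> nat list \<Rightarrow> bool" where
  "cylindric_partition c1 c2 p \<longleftrightarrow>
     is_partition (fst p) \<and> is_partition (snd p) \<and>
     (\<forall>j\<ge>1. part (fst p) j \<ge> part (snd p) (j + c2)) \<and>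
     (\<forall>j\<ge>1. part (snd p) j \<ge> part (fst p) (j + c1))"

definition tight :: "nat list \<times> nat list \<Rightarrow> bool" where
  "tight p \<longleftrightarrow> set (fst p) \<inter> set (snd p) = {}"

definition tight_cps :: "nat \<Rightarrow> nat \<Rightarrow> (nat list \<times> nat list) set" where
  "tight_cps c1 c2 = {p. cylindric_partition c1 c2 p \<and> tight p}"

definition max_part :: "nat list \<times> nat list \<Rightarrow> nat" where
  "max_part p = Max (insert 0 (set (fst p) \<union> set (snd p)))"

definition weight :: "nat list \<times> nat list \<Rightarrow> nat" where
  "weight p = sum_list (fst p) + sum_list (snd p)"

text \<open>
  The ring of formal power series in \<open>z\<close> and \<open>q\<close> is rendered as \<open>\<rat>[[q]][[z]]\<close>: the outer
  variable is \<open>z\<close>, the inner one is \<open>q\<close>.  The inverse of a series with invertible constant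
  coefficient is the ring inverse (see \<open>divide_fps_fps\<close> below).
\<close>

type_synonym zq_series = "rat fps fps"

definition zvar :: zq_series where "zvar = fps_X"

definition qvar :: zq_series where "qvar = fps_const fps_X"

definition T_gf :: "nat \<Rightarrow> nat \<Rightarrow> zq_series" where
  "T_gf c1 c2 = Abs_fps (\<lambda>m. Abs_fps (\<lambda>n.
     of_nat (card {p \<in> tight_cps c1 c2. max_part p = m \<and> weight p = n})))"

text \<open>The sets counted in \<^const>\<open>T_gf\<close> are finite, so \<^const>\<open>card\<close> really counts.\<close>

lemma finite_weight: "finite {p \<in> tight_cps c1 c2. max_part p = m \<and> weight p = n}"
proof -
  let ?S = "{xs. set xs \<subseteq> {..n} \<and> length xs \<le> n}"
  have len: "length xs \<le> sum_list xs" if "\<forall>x\<in>set xs. x > 0" for xs :: "nat list"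
    using that by (induction xs) auto
  have "xs \<in> ?S" if "is_partition xs" "sum_list xs \<le> n" for xs
    using that len[of xs] member_le_sum_list[of _ xs]
    by (force simp: is_partition_def)
  hence "p \<in> ?S \<times> ?S" if "p \<in> {p \<in> tight_cps c1 c2. max_part p = m \<and> weight p = n}" for p
    using that unfolding tight_cps_def cylindric_partition_def weight_def mem_Collect_eq mem_Times_iff
    by (metis (no_types, lifting) le_add1 le_add2)
  hence "{p \<in> tight_cps c1 c2. max_part p = m \<and> weight p = n} \<subseteq> ?S \<times> ?S"
    by blast
  moreover have "finite (?S \<times> ?S)"
    by (intro finite_cartesian_product finite_lists_length_le) auto
  ultimately show ?thesis by (rule finite_subset)
qed

definition qpoch :: "'a::comm_ring_1 \<Rightarrow> 'a \<Rightarrow> nat \<Rightarrow> 'a" where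
  "qpoch a q n = (\<Prod>k<n. 1 - a * q ^ k)"

abbreviation qfac :: "nat \<Rightarrow> zq_series" where
  "qfac n \<equiv> qpoch qvar qvar n"

definition inv_qfac :: "int \<Rightarrow> zq_series" where
  "inv_qfac k = (if k < 0 then 0 else inverse (qfac (nat k)))"

text \<open>
  All denominators below have constant coefficient 1, so division by them in \<^typ>\<open>zq_series\<close> is
  multiplication by the ring inverse.
\<close>

lemma divide_fps_fps:
  fixes f g :: zq_series
  assumes "fps_nth (fps_nth g 0) 0 \<noteq> 0"
  shows "f / g = f * inverse g" and "g * inverse g = 1"
proof -
  have "subdegree g = 0" using assms by (intro subdegree_eq_0) auto
  moreover have "g \<noteq> 0" using assms by auto
  ultimately show "f / g = f * inverse g" by (simp add: fps_divide_def)
  have "fps_nth g 0 * inverse (fps_nth g 0) = 1"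
    using assms by (rule inverse_mult_eq_1')
  then show "g * inverse g = 1"
    unfolding fps_inverse_def[of g] by (rule fps_right_inverse)
qed

lemma qpoch_nth_0_0:
  "fps_nth (fps_nth (qfac n) 0) 0 = 1"
  "fps_nth (fps_nth (qpoch (zvar * qvar) qvar n) 0) 0 = 1"
  by (induction n) (simp_all add: qpoch_def qvar_def zvar_def)

definition tail_sum :: "nat \<Rightarrow> (nat \<Rightarrow> nat) \<Rightarrow> nat \<Rightarrow> nat" where
  "tail_sum l n j = (\<Sum>k=j..l. n k)"

text \<open>
  Twice the exponent of \<open>q\<close> in the first sum; it is always even, so the division by 2 in
  \<open>summand1\<close> is exact.
\<close>

definition double_expo1 :: "nat \<Rightarrow> nat \<Rightarrow> (nat \<Rightarrow> nat) \<Rightarrow> nat" where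
  "double_expo1 l b n =
     (\<Sum>j=1..l. (tail_sum l n j)\<^sup>2) + (\<Sum>i=1..b. n (2*i - 1)) + (\<Sum>j=2*b+1..l. tail_sum l n j)"

lemma even_double_expo1:
  assumes "b \<le> l div 2"
  shows "even (double_expo1 l b n)"
proof -
  let ?N = "tail_sum l n"
  have odd_terms: "even ((\<Sum>i=1..b. n (2*i - 1)) + (\<Sum>j=1..2*b. ?N j))"
    using assms
  proof (induction b)
    case (Suc b)
    have "?N (2*b+1) = n (2*b+1) + ?N (2*b+2)"
      using Suc.prems unfolding tail_sum_def
      by (subst sum.atLeast_Suc_atMost) auto
    moreover have "even ((\<Sum>i=1..b. n (2*i - 1)) + (\<Sum>j=1..2*b. ?N j))"
      using Suc by simp
    moreover have "(\<Sum>j=1..2 * Suc b. ?N j) = (\<Sum>j=1..2*b. ?N j) + ?N (2*b+1) + ?N (2*b+2)"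
      and "(\<Sum>i=1..Suc b. n (2*i - 1)) = (\<Sum>i=1..b. n (2*i - 1)) + n (2*b+1)"
      by simp_all
    ultimately show ?case by presburger
  qed simp
  have "(\<Sum>j=1..l. ?N j) = (\<Sum>j=1..2*b. ?N j) + (\<Sum>j=2*b+1..l. ?N j)"
    using assms sum.ub_add_nat[of 1 "2*b" ?N "l - 2*b"] by simp
  moreover have "even ((\<Sum>j=1..l. (?N j)\<^sup>2) + (\<Sum>j=1..l. ?N j))"
    unfolding sum.distrib[symmetric] by (intro dvd_sum) simp
  ultimately show ?thesis
    using odd_terms unfolding double_expo1_def by presburger
qed

definition summand1 :: "nat \<Rightarrow> nat \<Rightarrow> (nat \<Rightarrow> nat) \<Rightarrow> zq_series" where
  "summand1 l b n = (let N = tail_sum l n in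
     zvar ^ N 1 * qvar ^ (double_expo1 l b n div 2) * qfac (N 1)
       / (qpoch (zvar * qvar) qvar (N 1) * (\<Prod>j=1..l. qfac (n j))))"

definition expo2 :: "nat \<Rightarrow> nat \<Rightarrow> (nat \<Rightarrow> nat) \<Rightarrow> nat" where
  "expo2 l b N = (\<Sum>i=1..l. (N i + 1) choose 2) - (\<Sum>i=1..b. N (2*i))"

text \<open>The subtraction in \<^const>\<open>expo2\<close> never truncates.\<close>

lemma expo2_no_truncation:
  fixes N :: "nat \<Rightarrow> nat"
  assumes "b \<le> l div 2"
  shows "(\<Sum>i=1..b. N (2*i)) \<le> (\<Sum>i=1..l. (N i + 1) choose 2)"
proof -
  have "(\<Sum>i=1..b. N (2*i)) = (\<Sum>j\<in>(\<lambda>i. 2*i) ` {1..b}. N j)"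
    by (subst sum.reindex) (auto simp: inj_on_def o_def)
  also have "\<dots> \<le> (\<Sum>j=1..l. N j)"
    using assms by (intro sum_mono2) auto
  also have "\<dots> \<le> (\<Sum>i=1..l. (N i + 1) choose 2)"
    by (intro sum_mono) (simp add: numeral_2_eq_2)
  finally show ?thesis .
qed

definition summand2 :: "nat \<Rightarrow> nat \<Rightarrow> (nat \<Rightarrow> nat) \<Rightarrow> zq_series" where
  "summand2 l b N =
     zvar ^ N 1 * qvar ^ expo2 l b N * qfac (N 1) / qpoch (zvar * qvar) qvar (N 1)
       * (\<Prod>j\<in>{1..<l}. inv_qfac (int (N j) - int (N (j + 1)))) * inv_qfac (int (N l))"

text \<open>Index tuples \<open>(n\<^sub>1, \<dots>, n\<^sub>l)\<close> are extensional functions on \<open>{1..l}\<close>.\<close>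

definition tuples :: "nat \<Rightarrow> (nat \<Rightarrow> nat) set" where
  "tuples l = ({1..l} \<rightarrow>\<^sub>E UNIV)"

text \<open>
  Infinite sums over tuples are taken with \<^const>\<open>HAS_SUM\<close> in the library topology on
  \<^typ>\<open>zq_series\<close>, which is the \<open>z\<close>-adic one: each power of \<open>z\<close> receives contributions from
  finitely many tuples only.
\<close>

end

theory Submission
  imports Defs "HOL-Computational_Algebra.Formal_Laurent_Series"
begin

text \<open>
  Record a tight cylindric partition by the differences \<open>h\<^sub>v\<close> between the numbers of parts \<open>\<ge> v\<close> in
  its two rows.  Tightness makes it recoverable from this sequence, and the profile condition only
  says that all \<open>h\<^sub>v\<close> lie in an interval of \<open>l + 1\<close> integers.  Hence the generating functions
  \<open>G\<^sub>x(m)\<close> of profile \<open>(l - x, x)\<close> and largest part at most \<open>m\<close> satisfy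
  \<open>G\<^sub>x(m) = \<Sum>\<^sub>y q\<^bsup>m|x - y|\<^esup> G\<^sub>y(m - 1)\<close>, \<open>G\<^sub>x(0) = 1\<close>.

  Since \<open>z\<^sup>N / (z; q)\<^bsub>N+1\<^esub>\<close> generates the \<open>q\<close>-binomials \<open>m\<close> over \<open>N\<close>, the multisums amount to
  \<open>G\<^sub>b = (U D)\<^sup>b U\<^bsup>l-2b\<^esup> 1\<close>, where \<open>D f(m)\<close> is the sum over \<open>k\<close> of \<open>f(k) q\<^bsup>k(k-1)/2\<^esup>\<close> times \<open>m\<close> over \<open>k\<close>,
  \<open>S f(m) = q\<^sup>m f(m)\<close> and \<open>U = D S\<close>.  With \<open>Z f(m) = (1 - q\<^sup>m) f(m - 1)\<close>, the operator
  \<open>C = S - Z + S\<^sup>-\<^sup>1 (1 - Z)\<close> commutes with \<open>U D\<close>, and \<open>C U U = S U U + U D\<close>.  This yields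
  \<open>C G\<^sub>b = G\<^bsub>b-1\<^esub> + G\<^bsub>b+1\<^esub>\<close>, which is the recurrence above multiplied by the inverse of the matrix
  \<open>q\<^bsup>m|x - y|\<^esup>\<close>, which is tridiagonal.
\<close>

section \<open>Gaussian binomial coefficients\<close>

text \<open>The Pascal rule avoids division, so one definition serves \<open>rat fps\<close>,
  Laurent series and \<open>zq_series\<close>, and homomorphisms pass through it.\<close>

fun qbin :: "'a::comm_ring_1 \<Rightarrow> nat \<Rightarrow> nat \<Rightarrow> 'a" where
  "qbin q n 0 = 1"
| "qbin q 0 (Suc k) = 0"
| "qbin q (Suc n) (Suc k) = qbin q n k + q ^ Suc k * qbin q n (Suc k)"

lemma qbin_eq_0: "n < k \<Longrightarrow> qbin q n k = 0"
  by (induction q n k rule: qbin.induct) auto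

text \<open>The absorption rule without division, valid even where \<open>1 - q ^ Suc k\<close> is
  no unit; it follows from the Pascal rule by induction on \<open>n\<close>.\<close>

lemma qbin_absorb: "(1 - q ^ Suc k) * qbin q (Suc n) (Suc k) = (1 - q ^ Suc n) * qbin q n k"
proof (induction n arbitrary: k)
  case 0
  show ?case by (cases k) auto
next
  case (Suc n)
  note IH = Suc.IH
  show ?case
  proof (cases k)
    case 0
    define a where "a = qbin q n (Suc 0)"
    have *: "(1 - q) * (1 + q * a) = 1 - q * q ^ n"
      using IH[of 0] by (simp add: a_def)
    have "(1 - q) * (1 + q * (1 + q * a)) = (1 - q) + q * ((1 - q) * (1 + q * a))"
      by (simp add: algebra_simps)
    also have "\<dots> = 1 - q * (q * q ^ n)"
      unfolding * by (simp add: algebra_simps)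
    finally show ?thesis using 0 by (simp add: a_def)
  next
    case (Suc j)
    define a where "a = qbin q n j"
    define b where "b = qbin q n (Suc j)"
    define c where "c = qbin q (Suc n) (Suc (Suc j))"
    have 1: "(1 - q * q^j) * (a + q * q^j * b) = (1 - q * q^n) * a"
      using IH[of j] by (simp add: a_def b_def)
    have 2: "(1 - q * (q * q^j)) * c = (1 - q * q^n) * b"
      using IH[of "Suc j"] by (simp add: b_def c_def)
    \<comment> \<open>The gap between the two sides combines the induction hypotheses at
      \<open>j\<close> and \<open>Suc j\<close>, with coefficients \<open>q\<close> and
      \<open>q ^ (j + 2)\<close>.\<close>
    have "(1 - q * (q * q^j)) * (a + q * q^j * b + q * (q * q^j) * c)
        - (1 - q * (q * q^n)) * (a + q * q^j * b)
        = q * ((1 - q * q^j) * (a + q * q^j * b) - (1 - q * q^n) * a)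
        + q * (q * q^j) * ((1 - q * (q * q^j)) * c - (1 - q * q^n) * b)"
      by (simp add: algebra_simps)
    also have "\<dots> = 0"
      by (simp only: 1 2 diff_self mult_zero_right add_0_left)
    finally have "(1 - q * (q * q^j)) * (a + q * q^j * b + q * (q * q^j) * c)
        = (1 - q * (q * q^n)) * (a + q * q^j * b)"
      by (simp only: right_minus_eq)
    then show ?thesis by (simp add: Suc a_def b_def c_def)
  qed
qed

text \<open>The companion rule, where \<open>1 - q ^ (n + 1 - k)\<close> is multiplied by
  \<open>q ^ k\<close> so that no truncated exponent occurs. Subtract \<open>qbin_absorb\<close> and
  apply the Pascal rule.\<close>

lemma qbin_absorb':
  "(q ^ k - q ^ Suc n) * qbin q (Suc n) k = (1 - q ^ Suc n) * (q ^ k * qbin q n k)"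
proof (cases k)
  case (Suc j)
  have "(q ^ Suc j - q ^ Suc n) * qbin q (Suc n) (Suc j) =
      (1 - q ^ Suc n) * qbin q (Suc n) (Suc j) - (1 - q ^ Suc j) * qbin q (Suc n) (Suc j)"
    by (simp only: algebra_simps)
  also have "\<dots> = (1 - q ^ Suc n) * (q ^ Suc j * qbin q n (Suc j))"
    unfolding qbin_absorb by (simp add: algebra_simps)
  finally show ?thesis using Suc by simp
qed simp

lemma qpoch_eq_qbin: "k \<le> n \<Longrightarrow> qpoch q q n = qbin q n k * qpoch q q k * qpoch q q (n - k)"
proof (induction n arbitrary: k)
  case 0
  then show ?case by (simp add: qpoch_def)
next
  case (Suc n)
  show ?case
  proof (cases k)
    case 0
    then show ?thesis by (simp add: qpoch_def)
  next
    case (Suc j)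
    have p: "qpoch q q (Suc i) = (1 - q ^ Suc i) * qpoch q q i" for i
      by (simp add: qpoch_def mult.commute)
    have "qbin q (Suc n) k * qpoch q q k * qpoch q q (Suc n - k)
        = ((1 - q ^ Suc j) * qbin q (Suc n) (Suc j)) * qpoch q q j * qpoch q q (n - j)"
      unfolding Suc p by (simp add: mult_ac)
    also have "\<dots> = (1 - q ^ Suc n) * (qbin q n j * qpoch q q j * qpoch q q (n - j))"
      unfolding qbin_absorb by (simp only: mult_ac)
    also have "\<dots> = qpoch q q (Suc n)"
      using Suc.IH[of j] Suc.prems Suc by (simp add: p)
    finally show ?thesis by simp
  qed
qed

lemma qbin_hom:
  assumes "h 0 = 0" "h 1 = 1" "\<And>x y. h (x + y) = h x + h y" "\<And>x y. h (x * y) = h x * h y"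
  shows "h (qbin q n k) = qbin (h q) n k"
proof -
  have "h (x ^ i) = h x ^ i" for x i by (induction i) (simp_all add: assms)
  then show ?thesis by (induction q n k rule: qbin.induct) (simp_all add: assms)
qed

section \<open>The operators\<close>

text \<open>
  \<open>dop\<close>, \<open>uop\<close>, \<open>wop\<close> and \<open>cop\<close> are the operators \<open>D\<close>, \<open>U\<close>, \<open>U D\<close> and \<open>C\<close> of the introduction, and
  \<open>cop'\<close> is \<open>D\<^sup>-\<^sup>1 C D\<close>.  In \<open>(1 - q ^ m) * f (m - 1)\<close>, which is \<open>Z f(m)\<close>, the truncated subtraction
  is harmless, since the factor \<open>1 - q ^ m\<close> vanishes for \<open>m = 0\<close>.
\<close>

definition dop :: "'a::comm_ring_1 \<Rightarrow> (nat \<Rightarrow> 'a) \<Rightarrow> nat \<Rightarrow> 'a" where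
  "dop q f m = (\<Sum>k\<le>m. qbin q m k * q ^ (k choose 2) * f k)"

definition uop :: "'a::comm_ring_1 \<Rightarrow> (nat \<Rightarrow> 'a) \<Rightarrow> nat \<Rightarrow> 'a" where
  "uop q f = dop q (\<lambda>k. q ^ k * f k)"

definition wop :: "'a::comm_ring_1 \<Rightarrow> (nat \<Rightarrow> 'a) \<Rightarrow> nat \<Rightarrow> 'a" where
  "wop q f = uop q (dop q f)"

lemma dop_add: "dop q (\<lambda>k. f k + g k) m = dop q f m + dop q g m"
  by (simp add: dop_def distrib_left sum.distrib)

lemma dop_diff: "dop q (\<lambda>k. f k - g k) m = dop q f m - dop q g m"
  by (simp add: dop_def right_diff_distrib sum_subtractf)

lemma dop_scale: "dop q (\<lambda>k. c * f k) m = c * dop q f m"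
  by (simp add: dop_def sum_distrib_left mult_ac)

lemma dop_0 [simp]: "dop q f 0 = f 0"
  by (simp add: dop_def numeral_2_eq_2)

lemma wop_add: "wop q (\<lambda>k. f k + g k) = (\<lambda>k. wop q f k + wop q g k)"
  by (simp add: fun_eq_iff wop_def uop_def dop_add distrib_left)

lemma wop_pow_add: "(wop q ^^ n) (\<lambda>k. f k + g k) = (\<lambda>k. (wop q ^^ n) f k + (wop q ^^ n) g k)"
  by (induction n) (simp_all add: wop_add)

text \<open>This is \<open>D Z = Z U\<close>: absorption turns \<open>1 - q ^ k\<close> into
  \<open>1 - q ^ m\<close>, and shifting \<open>k\<close> raises \<open>k choose 2\<close> by
  \<open>k\<close>, which supplies \<open>S\<close>.\<close>

lemma dop_shift:
  "dop q (\<lambda>k. (1 - q ^ k) * f (k - 1)) m = (1 - q ^ m) * dop q (\<lambda>k. q ^ k * f k) (m - 1)"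
proof (cases m)
  case (Suc n)
  have "dop q (\<lambda>k. (1 - q ^ k) * f (k - 1)) (Suc n) =
      (\<Sum>k\<le>n. qbin q (Suc n) (Suc k) * q ^ (Suc k choose 2) * ((1 - q ^ Suc k) * f k))"
    unfolding dop_def sum.atMost_Suc_shift by simp
  also have "\<dots> = (\<Sum>k\<le>n. ((1 - q ^ Suc k) * qbin q (Suc n) (Suc k)) * (q ^ (Suc k choose 2) * f k))"
    by (intro sum.cong refl) (simp only: mult_ac)
  also have "\<dots> = (1 - q ^ Suc n) * dop q (\<lambda>k. q ^ k * f k) n"
    unfolding qbin_absorb dop_def sum_distrib_left
    by (intro sum.cong refl) (simp add: numeral_2_eq_2 power_add mult_ac)
  finally show ?thesis using Suc by simp
qed simp

text \<open>This is \<open>S D = (1 - Z) U\<close>, obtained from the companion absorption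
  rule.\<close>

lemma power_mult_dop:
  "q ^ m * dop q f m = dop q (\<lambda>k. q ^ k * f k) m - (1 - q ^ m) * dop q (\<lambda>k. q ^ k * f k) (m - 1)"
proof (cases m)
  case (Suc n)
  have "dop q (\<lambda>k. q ^ k * f k) (Suc n) - q ^ Suc n * dop q f (Suc n) =
      (\<Sum>k\<le>Suc n. ((q ^ k - q ^ Suc n) * qbin q (Suc n) k) * (q ^ (k choose 2) * f k))"
    unfolding dop_def sum_distrib_left sum_subtractf[symmetric]
    by (intro sum.cong refl) (simp only: algebra_simps)
  also have "\<dots> = (1 - q ^ Suc n) * dop q (\<lambda>k. q ^ k * f k) n"
    unfolding qbin_absorb' dop_def sum_distrib_left
    by (simp add: qbin_eq_0 mult_ac)
  finally have "dop q (\<lambda>k. q ^ k * f k) (Suc n) - q ^ Suc n * dop q f (Suc n) =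
    (1 - q ^ Suc n) * dop q (\<lambda>k. q ^ k * f k) n" .
  then show ?thesis unfolding Suc by (simp add: algebra_simps)
qed simp

text \<open>Combining the two previous relations gives \<open>S D = D (S - Z)\<close>.\<close>

lemma power_mult_dop':
  "q ^ m * dop q f m = dop q (\<lambda>k. q ^ k * f k - (1 - q ^ k) * f (k - 1)) m"
  unfolding dop_diff dop_shift power_mult_dop ..

section \<open>Commutation relations of \<open>C\<close>\<close>

context
  fixes q :: "'a::field"
  assumes q: "q \<noteq> 0"
begin

definition cop :: "(nat \<Rightarrow> 'a) \<Rightarrow> nat \<Rightarrow> 'a" where
  "cop f m = q ^ m * f m - (1 - q ^ m) * f (m - 1) + (f m - (1 - q ^ m) * f (m - 1)) / q ^ m"

definition cop' :: "(nat \<Rightarrow> 'a) \<Rightarrow> nat \<Rightarrow> 'a" where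
  "cop' f m = (q ^ m * f m - (1 - q ^ m) * f (m - 1)) - (1 - q ^ m) * (f (m - 1) / q ^ (m - 1)) + f m / q ^ m"

lemma shift_dop:
  "(1 - q ^ m) * dop q f (m - 1) = dop q (\<lambda>k. (1 - q ^ k) * (f (k - 1) / q ^ (k - 1))) m"
  using dop_shift[of q "\<lambda>k. f k / q ^ k" m] q by simp

text \<open>This is \<open>S^-1 (1 - Z) D = D S^-1\<close>, which is
  \<open>S D = (1 - Z) D S\<close> applied to \<open>S^-1 f\<close>.\<close>

lemma dop_minus_shift:
  "(dop q f m - (1 - q ^ m) * dop q f (m - 1)) / q ^ m = dop q (\<lambda>k. f k / q ^ k) m"
  using power_mult_dop[of q m "\<lambda>k. f k / q ^ k"] q by (simp add: field_simps)

text \<open>Each of the three pieces \<open>S\<close>, \<open>Z\<close> and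
  \<open>S^-1 (1 - Z)\<close> of \<open>C\<close> is moved through \<open>D\<close>
  separately.\<close>

lemma cop_dop: "cop (dop q f) = dop q (cop' f)"
proof
  fix m
  have "cop (dop q f) m = dop q (\<lambda>k. q ^ k * f k - (1 - q ^ k) * f (k - 1)) m
    - dop q (\<lambda>k. (1 - q ^ k) * (f (k - 1) / q ^ (k - 1))) m + dop q (\<lambda>k. f k / q ^ k) m"
    unfolding cop_def dop_minus_shift unfolding power_mult_dop' shift_dop ..
  then show "cop (dop q f) m = dop q (cop' f) m"
    by (simp add: cop'_def[abs_def] dop_add dop_diff)
qed

text \<open>The second half of the commutation: \<open>C' S D = S D C\<close>, where
  \<open>C'\<close> is \<open>cop'\<close>.\<close>

lemma cop'_dop: "cop' (\<lambda>k. q ^ k * dop q f k) m = q ^ m * dop q (cop f) m"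
proof -
  \<comment> \<open>Pulling \<open>S\<close> out to the left uses
    \<open>Z S = q^-1 S Z\<close>.\<close>
  have "cop' (\<lambda>k. q ^ k * dop q f k) m = q ^ m * (q ^ m * dop q f m
     - inverse q * ((1 - q ^ m) * dop q f (m - 1)) + (dop q f m - (1 - q ^ m) * dop q f (m - 1)) / q ^ m)"
    using q by (cases m) (simp_all add: cop'_def field_simps)
  also have "q ^ m * dop q f m
     - inverse q * ((1 - q ^ m) * dop q f (m - 1)) + (dop q f m - (1 - q ^ m) * dop q f (m - 1)) / q ^ m
   = dop q (\<lambda>k. q ^ k * f k - (1 - q ^ k) * f (k - 1)) m
    - dop q (\<lambda>k. inverse q * ((1 - q ^ k) * (f (k - 1) / q ^ (k - 1)))) m + dop q (\<lambda>k. f k / q ^ k) m"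
    unfolding dop_minus_shift dop_scale unfolding power_mult_dop' shift_dop ..
  also have "\<dots> = dop q (\<lambda>k. (q ^ k * f k - (1 - q ^ k) * f (k - 1))
      - inverse q * ((1 - q ^ k) * (f (k - 1) / q ^ (k - 1))) + f k / q ^ k) m"
    by (simp add: dop_add dop_diff)
  \<comment> \<open>Now \<open>q^-1 Z S^-1 = S^-1 Z\<close> turns the result back into
    \<open>C\<close>.\<close>
  also have "(\<lambda>k. (q ^ k * f k - (1 - q ^ k) * f (k - 1))
      - inverse q * ((1 - q ^ k) * (f (k - 1) / q ^ (k - 1))) + f k / q ^ k) = cop f"
  proof
    fix k show "(q ^ k * f k - (1 - q ^ k) * f (k - 1))
      - inverse q * ((1 - q ^ k) * (f (k - 1) / q ^ (k - 1))) + f k / q ^ k = cop f k"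
      using q by (cases k) (simp_all add: cop_def field_simps)
  qed
  finally show ?thesis .
qed

text \<open>\<open>C D S D = D C' S D = D S D C\<close>.\<close>

lemma cop_wop: "cop (wop q f) = wop q (cop f)"
  by (simp add: wop_def uop_def cop_dop cop'_dop[abs_def])

lemma cop_wop_pow: "cop ((wop q ^^ n) f) = (wop q ^^ n) (cop f)"
  by (induction n) (simp_all add: cop_wop)

text \<open>After \<open>U = D S\<close>, the factor \<open>S\<close> cancels the
  \<open>S^-1\<close> produced by moving \<open>Z\<close> and \<open>S^-1 (1 - Z)\<close> through
  \<open>D\<close>; what remains is \<open>D (1 - Z)\<close>.\<close>

lemma cop_uop: "cop (uop q g) m = q ^ m * uop q g m + dop q (\<lambda>k. g k - (1 - q ^ k) * g (k - 1)) m"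
proof -
  have "cop (uop q g) m - q ^ m * uop q g m = dop q (\<lambda>k. q ^ k * g k / q ^ k) m
      - dop q (\<lambda>k. (1 - q ^ k) * (q ^ (k - 1) * g (k - 1) / q ^ (k - 1))) m"
    unfolding cop_def uop_def dop_minus_shift unfolding shift_dop by (simp only: algebra_simps)
  also have "\<dots> = dop q (\<lambda>k. g k - (1 - q ^ k) * g (k - 1)) m"
    using q by (simp add: dop_diff)
  finally show ?thesis by (simp add: algebra_simps)
qed

lemma cop_uop_1: "cop (uop q (\<lambda>_. 1)) = (\<lambda>m. q ^ m * uop q (\<lambda>_. 1) m + uop q (\<lambda>_. 1) m)"
  by (simp add: fun_eq_iff cop_uop) (simp add: uop_def)

text \<open>Here \<open>(1 - Z) U g = S D g\<close>, so the remainder \<open>D (1 - Z) U g\<close>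
  of \<open>cop_uop\<close> is \<open>U D g\<close>.\<close>

lemma cop_uop_uop: "cop (uop q (uop q g)) = (\<lambda>m. q ^ m * uop q (uop q g) m + wop q g m)"
proof
  fix m
  have "(\<lambda>k. uop q g k - (1 - q ^ k) * uop q g (k - 1)) = (\<lambda>k. q ^ k * dop q g k)"
    by (simp add: uop_def power_mult_dop)
  then show "cop (uop q (uop q g)) m = q ^ m * uop q (uop q g) m + wop q g m"
    by (simp add: cop_uop) (simp add: wop_def uop_def)
qed

lemma cop_1: "cop (\<lambda>_. 1) = (\<lambda>m. q ^ m + q ^ m)"
  using q by (simp add: cop_def fun_eq_iff)

end

section \<open>The functions \<open>G_b\<close> and their three-term relation\<close>

definition hsum :: "'a::comm_ring_1 \<Rightarrow> nat \<Rightarrow> nat \<Rightarrow> nat \<Rightarrow> 'a" where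
  "hsum q l b = (wop q ^^ b) ((uop q ^^ (l - 2 * b)) (\<lambda>_. 1))"

text \<open>Extends \<open>G_b\<close> from \<open>2 * b \<le> l\<close> to all indices up to
  \<open>l\<close> by reflection, as swapping the two rows of a pair demands.\<close>

definition hsum_sym :: "'a::comm_ring_1 \<Rightarrow> nat \<Rightarrow> nat \<Rightarrow> nat \<Rightarrow> 'a" where
  "hsum_sym q l y = hsum q l (min y (l - y))"

lemma wop_power_mult: "wop q (\<lambda>k. q ^ k * f k) = uop q (uop q f)"
  by (simp add: wop_def uop_def)

text \<open>Since \<open>U D S = U U\<close>, a factor \<open>S\<close> behind the last
  \<open>U D\<close> converts that \<open>U D\<close> into two factors \<open>U\<close> and so
  lowers the index by one.\<close>

lemma hsum_wop_power_mult:
  assumes "2 * Suc b \<le> l"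
  shows "(wop q ^^ Suc b) (\<lambda>k. q ^ k * (uop q ^^ (l - 2 * Suc b)) (\<lambda>_. 1) k) = hsum q l b"
proof -
  have "l - 2 * b = Suc (Suc (l - 2 * Suc b))" using assms by simp
  then show ?thesis
    unfolding hsum_def funpow_Suc_right o_apply wop_power_mult
    by (simp add: funpow_swap1)
qed

lemma hsum_0: "hsum q l b 0 = 1"
proof -
  have u: "(uop q ^^ n) (\<lambda>_. 1) 0 = 1" for n
    by (induction n) (simp_all add: uop_def)
  have "(wop q ^^ n) f 0 = f 0" for n and f :: "nat \<Rightarrow> 'a"
    by (induction n) (simp_all add: wop_def uop_def)
  then show ?thesis using u by (simp add: hsum_def)
qed

text \<open>\<open>C\<close> commutes past \<open>(U D)^b\<close> and acts on
  \<open>g = U^(l-2b) 1\<close>, giving \<open>S g\<close> plus a remainder. The first part yields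
  the left neighbour, or a boundary term if \<open>b = 0\<close>; the remainder yields the right
  neighbour.\<close>

lemma cop_hsum:
  fixes q :: "'a::field"
  assumes q: "q \<noteq> 0" and l: "l \<ge> 1" and b: "2 * b \<le> l"
  shows "cop q (hsum q l b) m =
    (if b = 0 then q ^ m * hsum q l 0 m else hsum q l (b - 1) m) + hsum_sym q l (b + 1) m"
proof -
  define g where "g = (uop q ^^ (l - 2 * b)) (\<lambda>_. 1)"
  have c: "cop q (hsum q l b) = (wop q ^^ b) (cop q g)"
    unfolding hsum_def g_def using cop_wop_pow[OF q] .
  have left: "(wop q ^^ b) (\<lambda>k. q ^ k * g k) m =
      (if b = 0 then q ^ m * hsum q l 0 m else hsum q l (b - 1) m)"
  proof (cases b)
    case 0
    then show ?thesis by (simp add: g_def hsum_def)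
  next
    case (Suc c)
    then show ?thesis using hsum_wop_power_mult[of c l q] b by (simp add: g_def)
  qed
  \<comment> \<open>The remainder is \<open>U D\<close> applied to a power of \<open>U\<close>, or
    \<open>g\<close> itself, or \<open>S 1\<close>, according as at least two, one or no factors
    \<open>U\<close> are left. In the last two cases the right neighbour lies past the middle and is
    reflected.\<close>
  have "\<exists>h. cop q g = (\<lambda>k. q ^ k * g k + h k) \<and> (wop q ^^ b) h = hsum_sym q l (b + 1)"
  proof -
    consider "2 * b + 2 \<le> l" | "l = 2 * b + 1" | "l = 2 * b" using b by linarith
    then show ?thesis
    proof cases
      case 1
      define j where "j = l - 2 * b - 2"
      have j: "l - 2 * b = Suc (Suc j)" using 1 by (simp add: j_def)
      have "min (b + 1) (l - (b + 1)) = b + 1" "l - 2 * (b + 1) = j" using 1 by (auto simp: j_def)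
      then have "hsum_sym q l (b + 1) = (wop q ^^ b) (wop q ((uop q ^^ j) (\<lambda>_. 1)))"
        by (simp add: hsum_sym_def hsum_def funpow_swap1)
      then show ?thesis by (auto simp: g_def j cop_uop_uop[OF q])
    next
      case 2
      then have "min (b + 1) (l - (b + 1)) = b" by simp
      then show ?thesis using 2 by (auto simp: g_def cop_uop_1[OF q] hsum_sym_def hsum_def)
    next
      case 3
      \<comment> \<open>Only here is \<open>l \<ge> 1\<close> used: it excludes
        \<open>b = 0\<close>.\<close>
      with l obtain c where c: "b = Suc c" by (cases b) auto
      have "hsum_sym q l (b + 1) = hsum q l c" using 3 c by (simp add: hsum_sym_def)
      also have "\<dots> = (wop q ^^ b) (\<lambda>k. q ^ k)"
        using hsum_wop_power_mult[of c l q] 3 c by simp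
      finally show ?thesis using 3 by (intro exI[of _ "(^) q"]) (simp add: g_def cop_1[OF q])
    qed
  qed
  then obtain h where h: "cop q g = (\<lambda>k. q ^ k * g k + h k)" "(wop q ^^ b) h = hsum_sym q l (b + 1)"
    by blast
  then show ?thesis unfolding c h(1) wop_pow_add left h(2)[symmetric] by simp
qed

text \<open>The lower half is \<open>cop_hsum\<close>; reflection gives the upper half and exchanges
  the two boundary cases.\<close>

lemma cop_hsum_sym:
  fixes q :: "'a::field"
  assumes q: "q \<noteq> 0" and l: "l \<ge> 1" and y: "y \<le> l"
  shows "cop q (hsum_sym q l y) m =
    (if y = 0 then q ^ m * hsum_sym q l 0 m else hsum_sym q l (y - 1) m) +
    (if y = l then q ^ m * hsum_sym q l l m else hsum_sym q l (y + 1) m)"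
proof -
  have main: "cop q (hsum_sym q l y) m =
    (if y = 0 then q ^ m * hsum_sym q l 0 m else hsum_sym q l (y - 1) m) + hsum_sym q l (y + 1) m"
    if "2 * y \<le> l" for y
  proof -
    have "min y (l - y) = y" "min (y - 1) (l - (y - 1)) = y - 1" using that by auto
    then show ?thesis using cop_hsum[OF q l that] by (simp add: hsum_sym_def)
  qed
  have sym: "hsum_sym q l (l - i) = hsum_sym q l i" if "i \<le> l" for i
    using that by (simp add: hsum_sym_def min.commute)
  show ?thesis
  proof (cases "2 * y \<le> l")
    case True
    then show ?thesis using main[of y] l by auto
  next
    case False
    then have "2 * (l - y) \<le> l" by simp
    from main[OF this] show ?thesis
      using sym[of y] sym[of "y - 1"] sym[of "y + 1"] sym[of l] y False by (auto simp: Suc_diff_le)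
  qed
qed

text \<open>The matrix \<open>p\<^bsup>|x - y|\<^esup>\<close> is, up to the factor \<open>1 - p\<^sup>2\<close>, inverse to the tridiagonal one.\<close>

lemma tridiagonal_inverse:
  fixes k :: "nat \<Rightarrow> 'a::comm_ring_1"
  assumes left: "k 0 = p * k 1" and right: "k (Suc n) = p * k n" and x: "1 \<le> x" "x \<le> n"
  defines "r \<equiv> \<lambda>y. (1 + p\<^sup>2) * k y - p * (k (y - 1) + k (y + 1))"
  shows "(\<Sum>y=1..n. p ^ ((x - y) + (y - x)) * r y) = (1 - p\<^sup>2) * k x"
proof -
  have L: "(\<Sum>y=1..x. p ^ (x - y) * r y) = k x - p * k (x + 1)" for x
  proof (induction x)
    case 0
    then show ?case using left by simp
  next
    case (Suc x)
    have "(\<Sum>y=1..x. p ^ (Suc x - y) * r y) = p * (\<Sum>y=1..x. p ^ (x - y) * r y)"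
      unfolding sum_distrib_left by (intro sum.cong refl) (simp add: Suc_diff_le mult_ac)
    then have "(\<Sum>y=1..Suc x. p ^ (Suc x - y) * r y) = p * (k x - p * k (x + 1)) + r (Suc x)"
      using Suc.IH by simp
    also have "\<dots> = k (Suc x) - p * k (Suc x + 1)"
      by (simp add: r_def algebra_simps power2_eq_square)
    finally show ?case .
  qed
  \<comment> \<open>The mirror image, starting from the empty sum at \<open>Suc n\<close>. The
    diagonal term belongs to both halves and is subtracted once below.\<close>
  have R: "(\<Sum>y=x..n. p ^ (y - x) * r y) = k x - p * k (x - 1)" if "1 \<le> x" "x \<le> Suc n" for x
    using that(2,1)
  proof (induction x rule: inc_induct)
    case base
    then show ?case using right by simp
  next
    case (step x)
    have "(\<Sum>y=Suc x..n. p ^ (y - x) * r y) = p * (\<Sum>y=Suc x..n. p ^ (y - Suc x) * r y)"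
      unfolding sum_distrib_left
      by (intro sum.cong refl) (auto simp: Suc_diff_Suc mult.assoc[symmetric] simp flip: power_Suc)
    then have "(\<Sum>y=x..n. p ^ (y - x) * r y) = r x + p * (k (Suc x) - p * k x)"
      using step by (simp add: sum.atLeast_Suc_atMost)
    also have "\<dots> = k x - p * k (x - 1)"
      by (simp add: r_def algebra_simps power2_eq_square)
    finally show ?case .
  qed
  have "{1..n} = {1..x} \<union> {Suc x..n}" using x by auto
  then have "(\<Sum>y=1..n. p ^ ((x - y) + (y - x)) * r y) =
      (\<Sum>y=1..x. p ^ ((x - y) + (y - x)) * r y) + (\<Sum>y=Suc x..n. p ^ ((x - y) + (y - x)) * r y)"
    by (simp add: sum.union_disjoint)
  also have "(\<Sum>y=1..x. p ^ ((x - y) + (y - x)) * r y) = (\<Sum>y=1..x. p ^ (x - y) * r y)"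
    by (intro sum.cong refl) simp
  also have "\<dots> = k x - p * k (x + 1)" by (rule L)
  also have "(\<Sum>y=Suc x..n. p ^ ((x - y) + (y - x)) * r y) = (\<Sum>y=x..n. p ^ (y - x) * r y) - r x"
    using x by (simp add: sum.atLeast_Suc_atMost)
  also have "(\<Sum>y=x..n. p ^ (y - x) * r y) = k x - p * k (x - 1)"
    using x by (intro R) auto
  finally show ?thesis by (simp add: r_def algebra_simps)
qed

text \<open>At \<open>Suc m\<close> the operator \<open>C\<close> involves both
  \<open>G_y(m + 1)\<close> and \<open>G_y(m)\<close>. Solving the three-term relation for the
  latter gives a tridiagonal system, which is inverted; \<open>q2\<close> permits cancelling
  \<open>1 - p\<^sup>2\<close>.\<close>

lemma hsum_sym_rec_field:
  fixes q :: "'a::field"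
  assumes q: "q \<noteq> 0" and q2: "(q ^ Suc m)\<^sup>2 \<noteq> 1" and l: "l \<ge> 1" and x: "x \<le> l"
  shows "hsum_sym q l x (Suc m) = (\<Sum>y\<le>l. (q ^ Suc m) ^ ((x - y) + (y - x)) * hsum_sym q l y m)"
proof -
  define p where "p = q ^ Suc m"
  have p: "p \<noteq> 0" using q by (simp add: p_def)
  define H where "H y = hsum_sym q l y (Suc m)" for y
  \<comment> \<open>Shifting the index by one and padding with \<open>p * H 0\<close> and
    \<open>p * H l\<close> absorbs both boundary cases into the general relation.\<close>
  define k where "k i = (if i = 0 then p * H 0 else if i = Suc (Suc l) then p * H l else H (i - 1))" for i
  have r: "(1 + p\<^sup>2) * k (Suc y) - p * (k y + k (Suc y + 1)) = (1 - p\<^sup>2) * hsum_sym q l y m"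
    if "y \<le> l" for y
  proof -
    have "cop q (hsum_sym q l y) (Suc m) = k y + k (Suc y + 1)"
      unfolding cop_hsum_sym[OF q l that] using that l
      by (auto simp: k_def H_def p_def)
    moreover have "p * cop q (hsum_sym q l y) (Suc m) = (1 + p\<^sup>2) * H y - (1 - p\<^sup>2) * hsum_sym q l y m"
      using p unfolding cop_def[OF q] p_def[symmetric] H_def
      by (simp add: field_simps power2_eq_square)
    moreover have "k (Suc y) = H y" using that by (simp add: k_def)
    ultimately show ?thesis by simp
  qed
  have "(1 - p\<^sup>2) * H x = (1 - p\<^sup>2) * k (Suc x)" using x by (simp add: k_def)
  also have "\<dots> = (\<Sum>y=1..Suc l. p ^ ((Suc x - y) + (y - Suc x)) *
      ((1 + p\<^sup>2) * k y - p * (k (y - 1) + k (y + 1))))"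
    using x by (intro tridiagonal_inverse[symmetric]) (auto simp: k_def)
  also have "\<dots> = (\<Sum>y\<le>l. p ^ ((x - y) + (y - x)) *
      ((1 + p\<^sup>2) * k (Suc y) - p * (k y + k (Suc y + 1))))"
    unfolding One_nat_def atMost_atLeast0 sum.shift_bounds_cl_Suc_ivl by simp
  also have "\<dots> = (\<Sum>y\<le>l. p ^ ((x - y) + (y - x)) * ((1 - p\<^sup>2) * hsum_sym q l y m))"
    by (intro sum.cong refl arg_cong2[of _ _ _ _ "(*)"] r) auto
  also have "\<dots> = (1 - p\<^sup>2) * (\<Sum>y\<le>l. p ^ ((x - y) + (y - x)) * hsum_sym q l y m)"
    unfolding sum_distrib_left by (intro sum.cong refl) (simp only: mult_ac)
  finally show ?thesis using q2 by (simp add: H_def p_def)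
qed

text \<open>Unlike \<open>C\<close>, the operators \<open>D\<close> and \<open>U\<close> use ring
  operations only, so an identity over Laurent series can be pulled back.\<close>

lemma hsum_sym_hom:
  assumes "h 0 = 0" "h 1 = 1" "\<And>x y. h (x + y) = h x + h y" "\<And>x y. h (x * y) = h x * h y"
  shows "h (hsum_sym q l y m) = hsum_sym (h q) l y m"
proof -
  have pow: "h (x ^ i) = h x ^ i" for x i by (induction i) (simp_all add: assms)
  have sum: "h (sum f A) = (\<Sum>x\<in>A. h (f x))" for f :: "nat \<Rightarrow> _" and A
    by (induction A rule: infinite_finite_induct) (simp_all add: assms)
  have d: "h (dop q f n) = dop (h q) (\<lambda>k. h (f k)) n" for f n
    by (simp add: dop_def sum assms pow qbin_hom[of h])
  have u: "h (uop q f n) = uop (h q) (\<lambda>k. h (f k)) n" for f n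
    by (simp add: uop_def d assms pow)
  have u': "(\<lambda>n. h ((uop q ^^ j) (\<lambda>_. 1) n)) = (uop (h q) ^^ j) (\<lambda>_. 1)" for j
    by (induction j) (simp_all add: u assms)
  have w: "(\<lambda>n. h ((wop q ^^ j) f n)) = (wop (h q) ^^ j) (\<lambda>n. h (f n))" for j f
    by (induction j) (simp_all add: wop_def u d)
  show ?thesis
    by (simp add: hsum_sym_def hsum_def fun_cong[OF w] u')
qed

text \<open>The operator \<open>C\<close> divides by powers of \<open>q\<close>, hence the detour through Laurent series.\<close>

lemma hsum_sym_rec:
  assumes l: "l \<ge> 1" and x: "x \<le> l"
  shows "hsum_sym (fps_X :: rat fps) l x (Suc m) =
    (\<Sum>y\<le>l. (fps_X ^ Suc m) ^ ((x - y) + (y - x)) * hsum_sym fps_X l y m)"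
proof -
  let ?h = "fps_to_fls :: rat fps \<Rightarrow> rat fls"
  have hom: "?h 0 = 0" "?h 1 = 1" "\<And>x y. ?h (x + y) = ?h x + ?h y" "\<And>x y. ?h (x * y) = ?h x * ?h y"
    by (simp_all add: fls_times_fps_to_fls)
  have pow: "?h (x ^ i) = ?h x ^ i" for x i by (induction i) (simp_all add: hom)
  have sum: "?h (sum f A) = (\<Sum>x\<in>A. ?h (f x))" for f :: "nat \<Rightarrow> _" and A
    by (induction A rule: infinite_finite_induct) (simp_all add: hom)
  have nz: "(?h fps_X ^ Suc m)\<^sup>2 \<noteq> 1"
  proof
    assume "(?h fps_X ^ Suc m)\<^sup>2 = 1"
    then have "?h ((fps_X ^ Suc m)\<^sup>2) = ?h 1" by (simp only: pow hom)
    then have "((fps_X :: rat fps) ^ Suc m)\<^sup>2 = 1" by (simp only: fps_to_fls_eq_iff)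
    then have "fps_nth (((fps_X :: rat fps) ^ Suc m)\<^sup>2) 0 = fps_nth 1 0" by (rule arg_cong)
    then show False by (simp add: power2_eq_square)
  qed
  note H = hsum_sym_hom[of ?h, OF hom]
  have "?h (hsum_sym fps_X l x (Suc m)) = hsum_sym (?h fps_X) l x (Suc m)"
    by (rule H)
  also have "\<dots> = (\<Sum>y\<le>l. (?h fps_X ^ Suc m) ^ ((x - y) + (y - x)) * hsum_sym (?h fps_X) l y m)"
    using nz l x by (intro hsum_sym_rec_field) simp_all
  also have "\<dots> = ?h (\<Sum>y\<le>l. (fps_X ^ Suc m) ^ ((x - y) + (y - x)) * hsum_sym fps_X l y m)"
    unfolding sum hom(4) pow H ..
  finally show ?thesis by (simp only: fps_to_fls_eq_iff)
qed

section \<open>Removing the largest parts\<close>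

text \<open>For a partition this is the \<open>v\<close>-th part of its conjugate.\<close>

definition num_ge :: "nat \<Rightarrow> nat list \<Rightarrow> nat" where
  "num_ge v xs = length (filter (\<lambda>a. v \<le> a) xs)"

lemma num_ge_append_replicate:
  "num_ge v (replicate a M @ r) = (if v \<le> M then a else 0) + num_ge v r"
  by (simp add: num_ge_def filter_replicate)

lemma num_ge_eq_0: "\<forall>x\<in>set r. x < v \<Longrightarrow> num_ge v r = 0"
  by (auto simp: num_ge_def filter_empty_conv not_le)

lemma part_ge_iff:
  assumes "is_partition xs" "1 \<le> j" "1 \<le> v"
  shows "v \<le> part xs j \<longleftrightarrow> j \<le> num_ge v xs"
  using assms
proof (induction xs arbitrary: j)
  case Nil
  then show ?case by (simp add: part_def num_ge_def)
next
  case (Cons x xs)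
  from Cons.prems have p: "is_partition xs" and le: "\<forall>a\<in>set xs. a \<le> x"
    by (auto simp: is_partition_def)
  show ?case
  proof (cases "v \<le> x")
    case True
    show ?thesis
    proof (cases "j = 1")
      case True
      then show ?thesis using \<open>v \<le> x\<close> by (simp add: part_def num_ge_def)
    next
      case False
      then obtain i where i: "j = Suc i" "1 \<le> i" using Cons.prems(2) by (cases j) auto
      then have "part (x # xs) j = part xs i" by (auto simp: part_def nth_Cons')
      then show ?thesis using Cons.IH[OF p i(2) Cons.prems(3)] True i by (simp add: num_ge_def)
    qed
  next
    case False
    have "num_ge v (x # xs) = 0" using False le by (intro num_ge_eq_0) auto
    moreover have "part (x # xs) j < v"
    proof (cases "j \<le> length (x # xs)")
      case True
      then have "part (x # xs) j \<in> set (x # xs)"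
        using Cons.prems(2) by (simp add: part_def del: set_simps)
      then show ?thesis using False le by auto
    qed (use Cons.prems(3) in \<open>simp add: part_def\<close>)
    ultimately show ?thesis using Cons.prems(2) by simp
  qed
qed

text \<open>Conjugation turns a shift of the index by \<open>c\<close> into an additive bound
  \<open>c\<close>.\<close>

lemma interlacing_iff_num_ge:
  assumes "is_partition r" "is_partition s"
  shows "(\<forall>j\<ge>1. part s (j + c) \<le> part r j) \<longleftrightarrow> (\<forall>v\<ge>1. num_ge v s \<le> num_ge v r + c)"
proof (intro iffI allI impI)
  fix v :: nat
  assume *: "\<forall>j\<ge>1. part s (j + c) \<le> part r j" and v: "1 \<le> v"
  show "num_ge v s \<le> num_ge v r + c"
  proof (rule ccontr)
    assume "\<not> num_ge v s \<le> num_ge v r + c"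
    \<comment> \<open>The index \<open>num_ge v r + 1\<close> is the first at which \<open>r\<close>
      has a part below \<open>v\<close>.\<close>
    then have "v \<le> part s (num_ge v r + 1 + c)"
      using part_ge_iff[OF assms(2) _ v] by simp
    also have "\<dots> \<le> part r (num_ge v r + 1)" using *[rule_format, of "num_ge v r + 1"] by simp
    finally show False using part_ge_iff[OF assms(1) _ v] by simp
  qed
next
  fix j :: nat
  assume *: "\<forall>v\<ge>1. num_ge v s \<le> num_ge v r + c" and j: "1 \<le> j"
  show "part s (j + c) \<le> part r j"
  proof (cases "part s (j + c) = 0")
    case False
    then have v: "1 \<le> part s (j + c)" by simp
    have "j + c \<le> num_ge (part s (j + c)) s"
      using part_ge_iff[OF assms(2) _ v, of "j + c"] j by simp
    also have "\<dots> \<le> num_ge (part s (j + c)) r + c" using * v by simp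
    finally show ?thesis using part_ge_iff[OF assms(1) j v] by simp
  qed simp
qed

definition bounded_tight :: "nat \<Rightarrow> nat \<Rightarrow> nat \<Rightarrow> (nat list \<times> nat list) set" where
  "bounded_tight l x m = {p \<in> tight_cps (l - x) x. max_part p \<le> m}"

text \<open>With \<open>h_v = num_ge v r - num_ge v s\<close> over the integers, the profile says
  \<open>-x \<le> h_v \<le> l - x\<close>.\<close>

lemma bounded_tight_iff:
  "(r, s) \<in> bounded_tight l x m \<longleftrightarrow> is_partition r \<and> is_partition s \<and>
    (\<forall>v\<ge>1. num_ge v s \<le> num_ge v r + x) \<and> (\<forall>v\<ge>1. num_ge v r \<le> num_ge v s + (l - x)) \<and>
    set r \<inter> set s = {} \<and> (\<forall>a\<in>set r \<union> set s. a \<le> m)"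
proof (cases "is_partition r \<and> is_partition s")
  case True
  then have "(\<forall>j\<ge>1. part s (j + x) \<le> part r j) \<longleftrightarrow> (\<forall>v\<ge>1. num_ge v s \<le> num_ge v r + x)"
    "(\<forall>j\<ge>1. part r (j + (l - x)) \<le> part s j) \<longleftrightarrow> (\<forall>v\<ge>1. num_ge v r \<le> num_ge v s + (l - x))"
    by (simp_all only: interlacing_iff_num_ge)
  moreover have "max_part (r, s) \<le> m \<longleftrightarrow> (\<forall>a\<in>set r \<union> set s. a \<le> m)"
    by (simp add: max_part_def)
  ultimately show ?thesis
    unfolding bounded_tight_def tight_cps_def cylindric_partition_def tight_def mem_Collect_eq
      fst_conv snd_conv by blast
qed (auto simp: bounded_tight_def tight_cps_def cylindric_partition_def)

lemma bounded_tight_0: "bounded_tight l x 0 = {([], [])}"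
proof -
  have "xs = []" if "is_partition xs" "\<forall>a\<in>set xs. a \<le> 0" for xs
    using that by (cases xs) (auto simp: is_partition_def)
  then have "p = ([], [])" if "p \<in> bounded_tight l x 0" for p
    using that by (cases p) (auto simp: bounded_tight_iff)
  moreover have "([], []) \<in> bounded_tight l x 0"
    by (simp add: bounded_tight_iff is_partition_def num_ge_def)
  ultimately show ?thesis by blast
qed

text \<open>At most one of the truncated differences is nonzero, so \<open>M\<close> enters at most
  one row, \<open>|x - y|\<close> times.\<close>

definition add_max_parts :: "nat \<Rightarrow> nat \<Rightarrow> nat \<Rightarrow> nat list \<times> nat list \<Rightarrow> nat list \<times> nat list" where
  "add_max_parts x M y p = (replicate (y - x) M @ fst p, replicate (x - y) M @ snd p)"

lemma is_partition_append_replicate: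
  assumes "\<forall>a\<in>set r. a \<le> M" "0 < M"
  shows "is_partition (replicate a M @ r) \<longleftrightarrow> is_partition r"
proof (induction a)
  case (Suc a)
  have "b \<le> M" if "b \<in> set (replicate a M @ r)" for b
    using that assms(1) by (cases "a = 0") auto
  then have "is_partition (M # (replicate a M @ r)) \<longleftrightarrow> is_partition (replicate a M @ r)"
    using assms(2) unfolding is_partition_def by (auto simp del: set_append)
  then show ?case using Suc.IH by simp
qed simp

lemma split_max_parts:
  assumes "is_partition xs" "\<forall>a\<in>set xs. a \<le> Suc m"
  obtains a r where "xs = replicate a (Suc m) @ r" "\<forall>b\<in>set r. b \<le> m"
  using assms
proof (induction xs arbitrary: thesis)
  case Nil
  then show ?case by (metis append.left_neutral empty_iff list.set(1) replicate_0)
next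
  case (Cons x xs)
  have xs: "is_partition xs" "\<forall>a\<in>set xs. a \<le> Suc m" "\<forall>a\<in>set xs. a \<le> x"
    using Cons.prems by (auto simp: is_partition_def)
  obtain a r where ar: "xs = replicate a (Suc m) @ r" "\<forall>b\<in>set r. b \<le> m"
    using Cons.IH[OF _ xs(1,2)] by blast
  show ?case
  proof (cases "x = Suc m")
    case True
    then show ?thesis using ar Cons.prems(1)[of "Suc a" r] by simp
  next
    case False
    then have "\<forall>b\<in>set (x # xs). b \<le> m" using xs(3) Cons.prems(3) by fastforce
    then show ?thesis using Cons.prems(1)[of 0 "x # xs"] by simp
  qed
qed

text \<open>Removing the parts \<open>Suc m\<close> lowers every \<open>h_v\<close> with
  \<open>v \<le> Suc m\<close> by \<open>h_(m+1)\<close>, so the admissible interval moves and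
  \<open>x\<close> becomes \<open>y = x + h_(m+1)\<close>.\<close>

lemma bounded_tight_Suc:
  assumes x: "x \<le> l"
  shows "bounded_tight l x (Suc m) = (\<Union>y\<le>l. add_max_parts x (Suc m) y ` bounded_tight l y m)"
proof (intro equalityI subsetI)
  fix p assume "p \<in> bounded_tight l x (Suc m)"
  moreover obtain r' s' where p: "p = (r', s')" by (cases p)
  ultimately have P: "is_partition r'" "is_partition s'"
    "\<And>v. v \<ge> 1 \<Longrightarrow> num_ge v s' \<le> num_ge v r' + x"
    "\<And>v. v \<ge> 1 \<Longrightarrow> num_ge v r' \<le> num_ge v s' + (l - x)"
    "set r' \<inter> set s' = {}" "\<forall>a\<in>set r' \<union> set s'. a \<le> Suc m"
    by (auto simp: bounded_tight_iff)
  obtain a r where r: "r' = replicate a (Suc m) @ r" "\<forall>b\<in>set r. b \<le> m"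
    using split_max_parts[OF P(1)] P(6) by blast
  obtain b s where s: "s' = replicate b (Suc m) @ s" "\<forall>b\<in>set s. b \<le> m"
    using split_max_parts[OF P(2)] P(6) by blast
  \<comment> \<open>Tightness forbids \<open>Suc m\<close> in both rows.\<close>
  have ab: "a = 0 \<or> b = 0" using P(5) r s by (cases a; cases b) auto
  have 0: "num_ge v r = 0" "num_ge v s = 0" if "v > m" for v
    using that r s by (auto intro!: num_ge_eq_0)
  have "b \<le> a + x" "a \<le> b + (l - x)"
    using P(3,4)[of "Suc m"] r(1) s(1) 0[of "Suc m"] by (auto simp: num_ge_append_replicate)
  define y where "y = x + a - b"
  have y: "y \<le> l" "y - x = a" "x - y = b"
    using ab \<open>b \<le> a + x\<close> \<open>a \<le> b + (l - x)\<close> x by (auto simp: y_def)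
  have "num_ge v s \<le> num_ge v r + y \<and> num_ge v r \<le> num_ge v s + (l - y)" if "v \<ge> 1" for v
  proof (cases "v \<le> Suc m")
    case True
    then have "b + num_ge v s \<le> a + num_ge v r + x" "a + num_ge v r \<le> b + num_ge v s + (l - x)"
      using P(3,4)[OF that] r(1) s(1) by (auto simp: num_ge_append_replicate)
    then show ?thesis using y x ab by linarith
  qed (simp add: 0)
  moreover have "is_partition r" "is_partition s"
    using P(1,2) r s is_partition_append_replicate[of _ "Suc m"] by (auto simp: le_Suc_eq)
  ultimately have "(r, s) \<in> bounded_tight l y m"
    using P(5) r s by (auto simp: bounded_tight_iff)
  moreover have "p = add_max_parts x (Suc m) y (r, s)"
    using p r(1) s(1) y by (simp add: add_max_parts_def)
  ultimately show "p \<in> (\<Union>y\<le>l. add_max_parts x (Suc m) y ` bounded_tight l y m)"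
    using y(1) by blast
next
  fix p assume "p \<in> (\<Union>y\<le>l. add_max_parts x (Suc m) y ` bounded_tight l y m)"
  then obtain y r s where y: "y \<le> l" and rs: "(r, s) \<in> bounded_tight l y m"
    and p: "p = (replicate (y - x) (Suc m) @ r, replicate (x - y) (Suc m) @ s)"
    by (auto simp: add_max_parts_def)
  from rs have P: "is_partition r" "is_partition s"
    "\<And>v. v \<ge> 1 \<Longrightarrow> num_ge v s \<le> num_ge v r + y"
    "\<And>v. v \<ge> 1 \<Longrightarrow> num_ge v r \<le> num_ge v s + (l - y)"
    "set r \<inter> set s = {}" "\<forall>a\<in>set r. a \<le> m" "\<forall>a\<in>set s. a \<le> m"
    by (auto simp: bounded_tight_iff)
  have 0: "num_ge v r = 0" "num_ge v s = 0" if "v > m" for v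
    using that P(6,7) by (auto intro!: num_ge_eq_0)
  have "num_ge v (snd p) \<le> num_ge v (fst p) + x \<and> num_ge v (fst p) \<le> num_ge v (snd p) + (l - x)"
    if "v \<ge> 1" for v
    using P(3,4)[OF that] 0[of v] x y unfolding p fst_conv snd_conv num_ge_append_replicate
    by (cases "v \<le> Suc m") auto
  moreover have "is_partition (fst p)" "is_partition (snd p)"
    using P(1,2,6,7) unfolding p fst_conv snd_conv
    by (subst is_partition_append_replicate; auto simp: le_Suc_eq)+
  moreover have "set (fst p) \<inter> set (snd p) = {}"
    using P(5,6,7) by (cases "x \<le> y") (auto simp: p)
  moreover have "\<forall>a\<in>set (fst p) \<union> set (snd p). a \<le> Suc m"
    using P(6,7) by (auto simp: p)
  ultimately show "p \<in> bounded_tight l x (Suc m)"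
    using bounded_tight_iff[of "fst p" "snd p" l x "Suc m"] by auto
qed

lemma finite_bounded_tight: "x \<le> l \<Longrightarrow> finite (bounded_tight l x m)"
  by (induction m arbitrary: x) (auto simp: bounded_tight_0 bounded_tight_Suc)

lemma inj_add_max_parts: "inj (add_max_parts x M y)"
  by (auto simp: inj_def add_max_parts_def)

text \<open>The numbers of parts above \<open>m\<close> in the two rows recover \<open>y\<close>, so
  the union in \<open>bounded_tight_Suc\<close> is disjoint.\<close>

lemma add_max_parts_eqD:
  assumes "p \<in> bounded_tight l y m" "p' \<in> bounded_tight l y' m"
    and eq: "add_max_parts x (Suc m) y p = add_max_parts x (Suc m) y' p'"
  shows "y = y'"
proof -
  have 0: "num_ge (Suc m) (fst p) = 0 \<and> num_ge (Suc m) (snd p) = 0"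
    if "p \<in> bounded_tight l y m" for p y
    using that by (cases p) (auto simp: bounded_tight_iff less_Suc_eq_le intro!: num_ge_eq_0)
  have "num_ge (Suc m) (fst (add_max_parts x (Suc m) y p)) = y - x \<and>
      num_ge (Suc m) (snd (add_max_parts x (Suc m) y p)) = x - y"
    if "p \<in> bounded_tight l y m" for p y
    using 0[OF that] by (simp add: add_max_parts_def num_ge_append_replicate)
  from this[OF assms(1)] this[OF assms(2)] eq have "y - x = y' - x" "x - y = x - y'" by auto
  then show ?thesis by linarith
qed

lemma weight_add_max_parts:
  "weight (add_max_parts x M y p) = M * ((x - y) + (y - x)) + weight p"
  by (simp add: weight_def add_max_parts_def sum_list_replicate algebra_simps)

section \<open>Generating functions of bounded tight pairs\<close>

definition bounded_gf :: "nat \<Rightarrow> nat \<Rightarrow> nat \<Rightarrow> rat fps" where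
  "bounded_gf l x m = (\<Sum>p\<in>bounded_tight l x m. fps_X ^ weight p)"

lemma bounded_gf_Suc:
  assumes x: "x \<le> l"
  shows "bounded_gf l x (Suc m) = (\<Sum>y\<le>l. (fps_X ^ Suc m) ^ ((x - y) + (y - x)) * bounded_gf l y m)"
proof -
  have disj: "add_max_parts x (Suc m) y ` bounded_tight l y m \<inter>
      add_max_parts x (Suc m) y' ` bounded_tight l y' m = {}" if "y \<noteq> y'" for y y'
  proof (rule equals0I)
    fix p assume "p \<in> add_max_parts x (Suc m) y ` bounded_tight l y m \<inter>
      add_max_parts x (Suc m) y' ` bounded_tight l y' m"
    then obtain a b where "a \<in> bounded_tight l y m" "b \<in> bounded_tight l y' m"
      "add_max_parts x (Suc m) y a = add_max_parts x (Suc m) y' b" by auto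
    then have "y = y'" by (rule add_max_parts_eqD)
    with that show False by simp
  qed
  have "bounded_gf l x (Suc m) =
      (\<Sum>y\<le>l. \<Sum>p\<in>add_max_parts x (Suc m) y ` bounded_tight l y m. fps_X ^ weight p)"
    unfolding bounded_gf_def bounded_tight_Suc[OF x]
    by (intro sum.UNION_disjoint) (simp_all add: finite_bounded_tight disj)
  also have "\<dots> = (\<Sum>y\<le>l. (fps_X ^ Suc m) ^ ((x - y) + (y - x)) * bounded_gf l y m)"
  proof (intro sum.cong refl)
    fix y
    have "inj_on (add_max_parts x (Suc m) y) (bounded_tight l y m)"
      using inj_add_max_parts by (rule inj_on_subset) simp
    then have "(\<Sum>p\<in>add_max_parts x (Suc m) y ` bounded_tight l y m. fps_X ^ weight p :: rat fps) =
        (\<Sum>p\<in>bounded_tight l y m. fps_X ^ weight (add_max_parts x (Suc m) y p))"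
      by (rule sum.reindex_cong) simp_all
    then show "(\<Sum>p\<in>add_max_parts x (Suc m) y ` bounded_tight l y m. fps_X ^ weight p) =
        (fps_X ^ Suc m) ^ ((x - y) + (y - x)) * bounded_gf l y m"
      by (simp only: weight_add_max_parts bounded_gf_def sum_distrib_left power_add power_mult)
  qed
  finally show ?thesis .
qed

text \<open>Both families have value 1 at \<open>m = 0\<close> and obey the same recurrence in
  \<open>m\<close>.\<close>

lemma bounded_gf_eq_hsum_sym:
  assumes "l \<ge> 1" "x \<le> l"
  shows "bounded_gf l x m = hsum_sym fps_X l x m"
  using assms(2)
proof (induction m arbitrary: x)
  case 0
  then show ?case by (simp add: bounded_gf_def bounded_tight_0 weight_def hsum_sym_def hsum_0)
next
  case (Suc m)
  then show ?case by (simp add: bounded_gf_Suc hsum_sym_rec[OF assms(1)] del: power_Suc)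
qed

text \<open>Pairs bounded by \<open>m\<close> split into those with maximum \<open>m\<close> and
  those bounded by \<open>m - 1\<close>; thus \<open>T_gf\<close> is \<open>1 - z\<close> times the
  series of the \<open>G_x(m) z^m\<close>.\<close>

lemma nth_T_gf:
  assumes x: "x \<le> l"
  shows "fps_nth (T_gf (l - x) x) m = bounded_gf l x m - (if m = 0 then 0 else bounded_gf l x (m - 1))"
proof -
  define A where "A = {p \<in> tight_cps (l - x) x. max_part p = m}"
  have fin: "finite A"
    by (rule finite_subset[OF _ finite_bounded_tight[OF x, of m]]) (auto simp: A_def bounded_tight_def)
  have "fps_nth (T_gf (l - x) x) m = (\<Sum>p\<in>A. fps_X ^ weight p)"
  proof (rule fps_ext)
    fix n
    have "fps_nth (\<Sum>p\<in>A. fps_X ^ weight p :: rat fps) n = (\<Sum>p\<in>A. if weight p = n then 1 else 0)"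
      unfolding fps_sum_nth by (intro sum.cong refl) (auto simp: fps_X_power_nth)
    also have "\<dots> = of_nat (card {p \<in> A. weight p = n})"
      using fin by (simp add: sum.inter_filter[symmetric])
    also have "{p \<in> A. weight p = n} = {p \<in> tight_cps (l - x) x. max_part p = m \<and> weight p = n}"
      by (auto simp: A_def)
    finally show "fps_nth (fps_nth (T_gf (l - x) x) m) n = fps_nth (\<Sum>p\<in>A. fps_X ^ weight p) n"
      by (simp add: T_gf_def)
  qed
  moreover have "bounded_gf l x m = (\<Sum>p\<in>A. fps_X ^ weight p) + (if m = 0 then 0 else bounded_gf l x (m - 1))"
  proof (cases m)
    case 0
    then have "A = bounded_tight l x m" by (auto simp: A_def bounded_tight_def)
    then show ?thesis using 0 by (simp add: bounded_gf_def)
  next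
    case (Suc k)
    have "bounded_tight l x m = A \<union> bounded_tight l x k" "A \<inter> bounded_tight l x k = {}"
      by (auto simp: A_def bounded_tight_def Suc)
    then show ?thesis
      using fin finite_bounded_tight[OF x] Suc by (simp add: bounded_gf_def sum.union_disjoint)
  qed
  ultimately show ?thesis by simp
qed

lemma nth_T_gf_hsum_sym:
  assumes "l \<ge> 1" "x \<le> l"
  shows "fps_nth (T_gf (l - x) x) m =
    hsum_sym fps_X l x m - (if m = 0 then 0 else hsum_sym fps_X l x (m - 1))"
  using assms by (simp add: nth_T_gf bounded_gf_eq_hsum_sym)

section \<open>The multisums\<close>

text \<open>The share of \<open>N_i\<close> in \<open>expo2\<close>: for even
  \<open>i \<le> 2 * b\<close> the subtracted \<open>N_i\<close> turns
  \<open>(k + 1) choose 2\<close> into \<open>k choose 2\<close>. Such levels act as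
  \<open>D\<close>, all others as \<open>U\<close>.\<close>

definition level_expo :: "nat \<Rightarrow> nat \<Rightarrow> nat \<Rightarrow> nat" where
  "level_expo b i k = (if even i \<and> i \<le> 2 * b then k choose 2 else (k + 1) choose 2)"

definition level_op :: "'a::comm_ring_1 \<Rightarrow> nat \<Rightarrow> nat \<Rightarrow> (nat \<Rightarrow> 'a) \<Rightarrow> nat \<Rightarrow> 'a" where
  "level_op q b i f m = (\<Sum>k\<le>m. qbin q m k * q ^ level_expo b i k * f k)"

lemma level_op_dop: "even i \<Longrightarrow> i \<le> 2 * b \<Longrightarrow> level_op q b i = dop q"
  by (intro ext) (simp add: level_op_def level_expo_def dop_def)

lemma level_op_uop: "\<not> (even i \<and> i \<le> 2 * b) \<Longrightarrow> level_op q b i = uop q"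
  by (intro ext) (auto simp: level_op_def level_expo_def dop_def uop_def numeral_2_eq_2 power_add
      mult_ac intro!: sum.cong)

text \<open>The composite of levels 1 to \<open>l\<close>, with level 1 outermost.\<close>

primrec chain :: "'a::comm_ring_1 \<Rightarrow> nat \<Rightarrow> nat \<Rightarrow> (nat \<Rightarrow> 'a) \<Rightarrow> nat \<Rightarrow> 'a" where
  "chain q b 0 f = f"
| "chain q b (Suc l) f = chain q b l (level_op q b (Suc l) f)"

lemma chain_eq_wop: "c \<le> b \<Longrightarrow> chain q b (2 * c) f = (wop q ^^ c) f"
proof (induction c arbitrary: f)
  case (Suc c)
  have "chain q b (2 * Suc c) f = chain q b (2 * c) (uop q (dop q f))"
    using Suc.prems by (simp add: level_op_dop level_op_uop)
  then show ?case
    using Suc by (simp add: wop_def[symmetric] funpow_swap1)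
qed simp

lemma chain_eq_hsum:
  assumes "2 * b \<le> l"
  shows "chain q b l (\<lambda>_. 1) = hsum q l b"
proof -
  have "chain q b (2 * b + j) f = (wop q ^^ b) ((uop q ^^ j) f)" for j f
    by (induction j arbitrary: f) (simp_all add: chain_eq_wop level_op_uop funpow_swap1)
  from this[of "l - 2 * b"] assms show ?thesis by (simp add: hsum_def)
qed

text \<open>The nested sums are flattened over one box, whose bound \<open>M\<close> need not depend
  on \<open>m\<close>. The update at 0 supplies \<open>N_0 = m\<close>, because 0 lies outside the
  domain of the tuples.\<close>

lemma chain_eq_sum:
  assumes "m \<le> M"
  shows "chain q b l f m = (\<Sum>N\<in>{1..l} \<rightarrow>\<^sub>E {..M}.
    (\<Prod>i=1..l. qbin q ((N(0 := m)) (i - 1)) (N i) * q ^ level_expo b i (N i)) * f ((N(0 := m)) l))"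
proof (induction l arbitrary: f)
  case 0
  then show ?case by simp
next
  case (Suc l)
  define P where "P N = (\<Prod>i=1..l. qbin q ((N(0 := m)) (i - 1)) (N i) * q ^ level_expo b i (N i))" for N
  define w where "w N k = qbin q ((N(0 := m)) l) k * q ^ level_expo b (Suc l) k * f k" for N k
  have bound: "(N(0 := m)) l \<le> M" if "N \<in> {1..l} \<rightarrow>\<^sub>E {..M}" for N
    using that assms by (cases l) (auto simp: PiE_iff)
  have "chain q b (Suc l) f m = (\<Sum>N\<in>{1..l} \<rightarrow>\<^sub>E {..M}. P N * (\<Sum>k\<le>(N(0 := m)) l. w N k))"
    unfolding chain.simps Suc.IH by (simp add: P_def w_def level_op_def)
  \<comment> \<open>Indices \<open>k\<close> above \<open>N_l\<close> add nothing, as their Gaussian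
    binomial vanishes.\<close>
  also have "\<dots> = (\<Sum>N\<in>{1..l} \<rightarrow>\<^sub>E {..M}. P N * (\<Sum>k\<le>M. w N k))"
    by (intro sum.cong refl arg_cong2[of _ _ _ _ "(*)"] sum.mono_neutral_left)
       (use bound in \<open>auto simp: w_def qbin_eq_0\<close>)
  also have "\<dots> = (\<Sum>(k, N)\<in>{..M} \<times> ({1..l} \<rightarrow>\<^sub>E {..M}). P N * w N k)"
    unfolding sum_distrib_left by (subst sum.swap) (simp add: sum.cartesian_product)
  also have "\<dots> = (\<Sum>N\<in>{1..Suc l} \<rightarrow>\<^sub>E {..M}.
      (\<Prod>i=1..Suc l. qbin q ((N(0 := m)) (i - 1)) (N i) * q ^ level_expo b i (N i)) * f ((N(0 := m)) (Suc l)))"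
  proof (rule sum.reindex_cong[symmetric])
    show "inj_on (\<lambda>(k, N). N(Suc l := k)) ({..M} \<times> ({1..l} \<rightarrow>\<^sub>E {..M}))"
      by (rule inj_combinator) simp
    show "{1..Suc l} \<rightarrow>\<^sub>E {..M} = (\<lambda>(k, N). N(Suc l := k)) ` ({..M} \<times> ({1..l} \<rightarrow>\<^sub>E {..M}))"
    proof -
      have "{1..Suc l} = insert (Suc l) {1..l}" by auto
      then show ?thesis by (simp only: PiE_insert_eq)
    qed
    fix kN assume "kN \<in> {..M} \<times> ({1..l} \<rightarrow>\<^sub>E {..M})"
    obtain k N where kN: "kN = (k, N)" by (cases kN)
    have "(\<Prod>i=1..l. qbin q (((N(Suc l := k))(0 := m)) (i - 1)) ((N(Suc l := k)) i) *
        q ^ level_expo b i ((N(Suc l := k)) i)) = P N"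
      unfolding P_def by (intro prod.cong refl) auto
    moreover have "((N(Suc l := k))(0 := m)) l = (N(0 := m)) l" by simp
    ultimately show "(\<Prod>i=1..Suc l. qbin q ((((\<lambda>(k, N). N(Suc l := k)) kN)(0 := m)) (i - 1))
        (((\<lambda>(k, N). N(Suc l := k)) kN) i) * q ^ level_expo b i (((\<lambda>(k, N). N(Suc l := k)) kN) i)) *
        f ((((\<lambda>(k, N). N(Suc l := k)) kN)(0 := m)) (Suc l)) = (case kN of (k, N) \<Rightarrow> P N * w N k)"
      unfolding kN by (simp add: w_def mult_ac)
  qed
  finally show ?case .
qed

lemma sum_level_expo:
  assumes "b \<le> l div 2"
  shows "(\<Sum>i=1..l. level_expo b i (N i)) = expo2 l b N"
proof -
  have "(\<Sum>i=1..b. N (2 * i)) = (\<Sum>j\<in>(\<lambda>i. 2 * i) ` {1..b}. N j)"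
    by (subst sum.reindex) (auto simp: inj_on_def)
  also have "(\<lambda>i. 2 * i) ` {1..b} = {i \<in> {1..l}. even i \<and> i \<le> 2 * b}"
    using assms by (auto elim!: evenE)
  also have "sum N \<dots> = (\<Sum>i=1..l. if even i \<and> i \<le> 2 * b then N i else 0)"
    by (simp only: sum.inter_filter finite_atLeastAtMost)
  finally have "(\<Sum>i=1..l. level_expo b i (N i)) + (\<Sum>i=1..b. N (2 * i)) = (\<Sum>i=1..l. (N i + 1) choose 2)"
    by (simp add: sum.distrib[symmetric])
       (intro sum.cong refl, simp add: level_expo_def numeral_2_eq_2)
  then show ?thesis by (simp add: expo2_def)
qed

text \<open>The Gaussian binomials multiply to the \<open>q\<close>-multinomial coefficient with
  entries \<open>m - N_1, N_1 - N_2, ..., N_l\<close>.\<close>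

definition qmultinomial_term :: "'a::comm_ring_1 \<Rightarrow> nat \<Rightarrow> nat \<Rightarrow> nat \<Rightarrow> (nat \<Rightarrow> nat) \<Rightarrow> 'a" where
  "qmultinomial_term q l b m N =
    qbin q m (N 1) * q ^ expo2 l b N * (\<Prod>j\<in>{1..<l}. qbin q (N j) (N (j + 1)))"

lemma hsum_eq_sum:
  assumes l: "l \<ge> 1" and b: "b \<le> l div 2" and "m \<le> M"
  shows "hsum q l b m = (\<Sum>N\<in>{1..l} \<rightarrow>\<^sub>E {..M}. qmultinomial_term q l b m N)"
proof -
  have "hsum q l b m = chain q b l (\<lambda>_. 1) m"
    using b by (subst chain_eq_hsum) auto
  also have "\<dots> = (\<Sum>N\<in>{1..l} \<rightarrow>\<^sub>E {..M}. qmultinomial_term q l b m N)"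
    unfolding chain_eq_sum[OF assms(3)]
  proof (intro sum.cong refl)
    fix N :: "nat \<Rightarrow> nat"
    have "(\<Prod>i=1..l. qbin q ((N(0 := m)) (i - 1)) (N i)) =
        qbin q m (N 1) * (\<Prod>i=Suc 1..l. qbin q ((N(0 := m)) (i - 1)) (N i))"
      using l by (subst prod.atLeast_Suc_atMost) auto
    also have "(\<Prod>i=Suc 1..l. qbin q ((N(0 := m)) (i - 1)) (N i)) =
        (\<Prod>j\<in>{1..<l}. qbin q (N j) (N (j + 1)))"
      by (rule prod.reindex_bij_witness[of _ Suc "\<lambda>i. i - 1"]) auto
    finally show "(\<Prod>i=1..l. qbin q ((N(0 := m)) (i - 1)) (N i) * q ^ level_expo b i (N i)) * 1 =
        qmultinomial_term q l b m N"
      by (simp add: prod.distrib power_sum[symmetric] sum_level_expo[OF b, unfolded One_nat_def] qmultinomial_term_def mult_ac)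
  qed
  finally show ?thesis .
qed

text \<open>A nonzero term forces \<open>m \<ge> N_1 \<ge> ... \<ge> N_l\<close>.\<close>

lemma qmultinomial_term_eq_0:
  assumes "1 \<le> i" "i \<le> l" "m < N i"
  shows "qmultinomial_term q l b m N = 0"
proof (rule ccontr)
  assume "qmultinomial_term q l b m N \<noteq> 0"
  then have 1: "qbin q m (N 1) \<noteq> 0" and prod: "(\<Prod>j\<in>{1..<l}. qbin q (N j) (N (j + 1))) \<noteq> 0"
    by (auto simp: qmultinomial_term_def)
  have step: "N (Suc j) \<le> N j" if "1 \<le> j" "j < l" for j
  proof (rule ccontr)
    assume "\<not> N (Suc j) \<le> N j"
    then have "qbin q (N j) (N (j + 1)) = 0" by (simp add: qbin_eq_0)
    then show False using prod that by (subst (asm) prod.remove[of _ j]) auto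
  qed
  have "N i \<le> N 1" using assms(1,2)
  proof (induction i rule: dec_induct)
    case (step j)
    then show ?case using \<open>\<And>j. 1 \<le> j \<Longrightarrow> j < l \<Longrightarrow> N (Suc j) \<le> N j\<close>[of j] by simp
  qed simp
  moreover have "N 1 \<le> m" using 1 qbin_eq_0[of m "N 1" q] by (meson not_le)
  ultimately show False using assms(3) by simp
qed

section \<open>The summands as formal power series\<close>

definition qbin_gf :: "nat \<Rightarrow> zq_series" where
  "qbin_gf n = Abs_fps (\<lambda>m. qbin fps_X m n)"

text \<open>The Pascal rule, read as an equation between generating functions in
  \<open>z\<close>.\<close>

lemma qbin_gf_Suc: "qbin_gf (Suc n) * (1 - zvar * qvar * qvar ^ n) = zvar * qbin_gf n"
proof (rule fps_ext)
  fix m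
  have "qbin_gf (Suc n) * (1 - zvar * qvar * qvar ^ n) =
      qbin_gf (Suc n) - zvar * (qbin_gf (Suc n) * fps_const (fps_X ^ Suc n))"
    by (simp add: qvar_def algebra_simps fps_const_power)
  then show "fps_nth (qbin_gf (Suc n) * (1 - zvar * qvar * qvar ^ n)) m = fps_nth (zvar * qbin_gf n) m"
    by (cases m) (simp_all add: zvar_def qbin_gf_def mult_ac)
qed

lemma qbin_gf_mult_qpoch: "qbin_gf n * (1 - zvar) * qpoch (zvar * qvar) qvar n = zvar ^ n"
proof (induction n)
  case 0
  have "qbin_gf 0 * (1 - zvar) = 1"
  proof (rule fps_ext)
    fix m show "fps_nth (qbin_gf 0 * (1 - zvar)) m = fps_nth 1 m"
      by (cases m) (simp_all add: zvar_def qbin_gf_def right_diff_distrib)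
  qed
  then show ?case by (simp add: qpoch_def)
next
  case (Suc n)
  have "qbin_gf (Suc n) * (1 - zvar) * qpoch (zvar * qvar) qvar (Suc n) =
      (qbin_gf (Suc n) * (1 - zvar * qvar * qvar ^ n)) * ((1 - zvar) * qpoch (zvar * qvar) qvar n)"
    by (simp add: qpoch_def mult_ac)
  also have "\<dots> = zvar ^ Suc n"
    unfolding qbin_gf_Suc using Suc.IH by (simp add: mult_ac)
  finally show ?case .
qed

lemma qfac_inverse: "qfac n * inverse (qfac n) = 1"
  by (intro divide_fps_fps(2)) (simp add: qpoch_nth_0_0)

text \<open>For \<open>k > n\<close> both sides are 0, by the convention for negative
  indices.\<close>

lemma inv_qfac_mult:
  "inv_qfac (int n - int k) * inv_qfac (int k) = qbin qvar n k * inv_qfac (int n)"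
proof (cases "k \<le> n")
  case True
  have "inverse (qfac k) * inverse (qfac (n - k)) =
      inverse (qfac k) * inverse (qfac (n - k)) * (qfac n * inverse (qfac n))"
    by (simp add: qfac_inverse)
  also have "\<dots> = (qfac k * inverse (qfac k)) * (qfac (n - k) * inverse (qfac (n - k))) *
      (qbin qvar n k * inverse (qfac n))"
    unfolding qpoch_eq_qbin[OF True] by (simp only: mult_ac)
  finally show ?thesis using True by (simp add: inv_qfac_def qfac_inverse nat_diff_distrib' mult.commute)
qed (simp add: inv_qfac_def qbin_eq_0)

text \<open>Peeling off the last index by \<open>inv_qfac_mult\<close> telescopes the product down
  to \<open>1 / (q)_(N_1)\<close>, which the leading factor cancels.\<close>

lemma prod_inv_qfac:
  fixes N :: "nat \<Rightarrow> nat"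
  assumes "l \<ge> 1"
  shows "qfac (N 1) * (\<Prod>j\<in>{1..<l}. inv_qfac (int (N j) - int (N (j + 1)))) * inv_qfac (int (N l)) =
    (\<Prod>j\<in>{1..<l}. qbin qvar (N j) (N (j + 1)))"
  using assms
proof (induction l rule: dec_induct)
  case base
  then show ?case by (simp add: inv_qfac_def qfac_inverse)
next
  case (step l)
  let ?P = "qfac (N 1) * (\<Prod>j\<in>{1..<l}. inv_qfac (int (N j) - int (N (j + 1))))"
  have "qfac (N 1) * (\<Prod>j\<in>{1..<Suc l}. inv_qfac (int (N j) - int (N (j + 1)))) * inv_qfac (int (N (Suc l)))
      = ?P * (inv_qfac (int (N l) - int (N (Suc l))) * inv_qfac (int (N (Suc l))))"
    using step by (simp add: mult_ac)
  also have "\<dots> = (?P * inv_qfac (int (N l))) * qbin qvar (N l) (N (Suc l))"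
    unfolding inv_qfac_mult by (simp only: mult_ac)
  also have "\<dots> = (\<Prod>j\<in>{1..<Suc l}. qbin qvar (N j) (N (j + 1)))"
    unfolding step.IH using step by (simp add: mult_ac)
  finally show ?case .
qed

lemma qbin_qvar: "qbin qvar n k = fps_const (qbin fps_X n k)"
  unfolding qvar_def by (rule qbin_hom[symmetric]) simp_all

lemma fps_const_prod: "(\<Prod>x\<in>A. fps_const (f x)) = fps_const (\<Prod>x\<in>A. f x :: 'a::comm_ring_1)"
  by (induction A rule: infinite_finite_induct) simp_all

text \<open>The factor \<open>1 - z\<close> here matches the differences in \<open>nth_T_gf\<close>,
  so the identity reduces to one for each \<open>G_b(m)\<close>.\<close>

lemma summand2_eq:
  assumes "l \<ge> 1"
  shows "summand2 l b N = (1 - zvar) * Abs_fps (\<lambda>m. qmultinomial_term fps_X l b m N)"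
proof -
  let ?Q = "qpoch (zvar * qvar) qvar (N 1)"
  have unit: "f / ?Q = f * inverse ?Q" "?Q * inverse ?Q = 1" for f
    by (intro divide_fps_fps; simp add: qpoch_nth_0_0)+
  have "summand2 l b N = zvar ^ N 1 * inverse ?Q * qvar ^ expo2 l b N *
      (\<Prod>j\<in>{1..<l}. qbin qvar (N j) (N (j + 1)))"
    unfolding summand2_def prod_inv_qfac[OF assms, symmetric] unit(1) by (simp only: mult_ac)
  also have "zvar ^ N 1 * inverse ?Q = qbin_gf (N 1) * (1 - zvar) * (?Q * inverse ?Q)"
    unfolding qbin_gf_mult_qpoch[symmetric] by (simp only: mult_ac)
  also have "\<dots> = (1 - zvar) * qbin_gf (N 1)"
    unfolding unit(2) by (simp add: mult_ac)
  also have "(1 - zvar) * qbin_gf (N 1) * qvar ^ expo2 l b N * (\<Prod>j\<in>{1..<l}. qbin qvar (N j) (N (j + 1))) =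
     (1 - zvar) * (qbin_gf (N 1) * fps_const (fps_X ^ expo2 l b N * (\<Prod>j\<in>{1..<l}. qbin fps_X (N j) (N (j + 1)))))"
    unfolding qbin_qvar fps_const_prod by (simp add: qvar_def fps_const_power mult_ac)
  also have "qbin_gf (N 1) * fps_const (fps_X ^ expo2 l b N * (\<Prod>j\<in>{1..<l}. qbin fps_X (N j) (N (j + 1)))) =
     Abs_fps (\<lambda>m. qmultinomial_term fps_X l b m N)"
    by (rule fps_ext) (simp add: qbin_gf_def qmultinomial_term_def mult_ac)
  finally show ?thesis .
qed

lemma nth_summand2:
  assumes "l \<ge> 1"
  shows "fps_nth (summand2 l b N) m = qmultinomial_term fps_X l b m N -
    (if m = 0 then 0 else qmultinomial_term fps_X l b (m - 1) N)"
  unfolding summand2_eq[OF assms] by (simp add: zvar_def left_diff_distrib)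

section \<open>Coefficientwise summation\<close>

lemma has_sum_fpsI:
  fixes f :: "'i \<Rightarrow> 'a::comm_ring_1 fps"
  assumes "\<And>n. finite (F n)" "\<And>n. F n \<subseteq> A"
    and "\<And>n x. x \<in> A - F n \<Longrightarrow> fps_nth (f x) n = 0"
    and "\<And>n. (\<Sum>x\<in>F n. fps_nth (f x) n) = fps_nth S n"
  shows "(f has_sum S) A"
  unfolding has_sum_def
proof (rule tendsto_fpsI)
  fix n
  show "\<forall>\<^sub>F X in finite_subsets_at_top A. fps_nth (sum f X) n = fps_nth S n"
    unfolding eventually_finite_subsets_at_top
  proof (intro exI[of _ "F n"] conjI allI impI)
    fix X assume X: "finite X \<and> F n \<subseteq> X \<and> X \<subseteq> A"
    have "fps_nth (sum f X) n = (\<Sum>x\<in>X. fps_nth (f x) n)" by (simp add: fps_sum_nth)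
    also have "\<dots> = (\<Sum>x\<in>F n. fps_nth (f x) n)"
      using X assms(3) by (intro sum.mono_neutral_right) auto
    finally show "fps_nth (sum f X) n = fps_nth S n" using assms(4) by simp
  qed (use assms(1,2) in auto)
qed

text \<open>Only tuples bounded by \<open>m\<close> reach \<open>z^m\<close>. Both
  \<open>G_b(m)\<close> and \<open>G_b(m - 1)\<close> are expanded over this same box.\<close>

lemma has_sum_summand2:
  assumes l: "l \<ge> 1" and b: "b \<le> l div 2"
    and S: "\<And>m. fps_nth S m = hsum fps_X l b m - (if m = 0 then 0 else hsum fps_X l b (m - 1))"
  shows "(summand2 l b has_sum S) (tuples l)"
proof (rule has_sum_fpsI[where F = "\<lambda>m. {1..l} \<rightarrow>\<^sub>E {..m}"])
  fix m :: nat
  show "finite ({1..l} \<rightarrow>\<^sub>E {..m})" by (intro finite_PiE) auto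
  show "{1..l} \<rightarrow>\<^sub>E {..m} \<subseteq> tuples l" unfolding tuples_def by (intro PiE_mono) auto
  show "fps_nth (summand2 l b N) m = 0" if "N \<in> tuples l - ({1..l} \<rightarrow>\<^sub>E {..m})" for N
  proof -
    from that obtain i where i: "1 \<le> i" "i \<le> l" "m < N i"
      by (auto simp: tuples_def PiE_iff not_le)
    then have "qmultinomial_term fps_X l b m N = (0 :: rat fps)"
      "qmultinomial_term fps_X l b (m - 1) N = (0 :: rat fps)"
      by (auto intro: qmultinomial_term_eq_0)
    then show ?thesis by (simp add: nth_summand2[OF l])
  qed
  show "(\<Sum>N\<in>{1..l} \<rightarrow>\<^sub>E {..m}. fps_nth (summand2 l b N) m) = fps_nth S m"
    unfolding nth_summand2[OF l] S sum_subtractf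
    by (simp add: hsum_eq_sum[OF l b, of _ m])
qed

section \<open>Passing from the second sum to the first\<close>

lemma tail_sum_rec: "j \<le> l \<Longrightarrow> tail_sum l n j = n j + tail_sum l n (Suc j)"
  by (simp add: tail_sum_def sum.atLeast_Suc_atMost)

lemma tail_sum_last: "tail_sum l n l = n l"
  by (simp add: tail_sum_def)

lemma double_expo1_eq:
  assumes b: "b \<le> l div 2"
  shows "double_expo1 l b n = 2 * expo2 l b (tail_sum l n)"
proof -
  let ?N = "tail_sum l n"
  \<comment> \<open>Each \<open>n_(2i-1)\<close> equals \<open>N_(2i-1) - N_(2i)\<close>.\<close>
  have odd_terms: "(\<Sum>i=1..b. n (2*i - 1)) + 2 * (\<Sum>i=1..b. ?N (2*i)) = (\<Sum>j=1..2*b. ?N j)"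
    using b
  proof (induction b)
    case (Suc b)
    then have "?N (2*b+1) = n (2*b+1) + ?N (2*b+2)" using tail_sum_rec[of "2*b+1" l n] by simp
    then show ?case using Suc by simp
  qed simp
  have split: "(\<Sum>j=1..l. ?N j) = (\<Sum>j=1..2*b. ?N j) + (\<Sum>j=2*b+1..l. ?N j)"
    using b sum.ub_add_nat[of 1 "2*b" ?N "l - 2*b"] by simp
  have "2 * ((k + 1) choose 2) = k\<^sup>2 + k" for k :: nat
    by (simp add: choose_two power2_eq_square)
  then have "2 * (\<Sum>j=1..l. (?N j + 1) choose 2) = (\<Sum>j=1..l. (?N j)\<^sup>2) + (\<Sum>j=1..l. ?N j)"
    by (simp add: sum_distrib_left sum.distrib)
  then show ?thesis
    using odd_terms split expo2_no_truncation[OF b, of ?N]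
    unfolding double_expo1_def expo2_def by linarith
qed

lemma nth_prod_qfac: "fps_nth (fps_nth (\<Prod>j\<in>A. qfac (n j)) 0) 0 = 1"
  by (induction A rule: infinite_finite_induct) (simp_all add: qpoch_nth_0_0)

text \<open>Argued through uniqueness of ring inverses, since the coefficients
  \<open>rat fps\<close> do not form a field.\<close>

lemma inverse_mult_zq:
  fixes a b :: zq_series
  assumes "fps_nth (fps_nth a 0) 0 = 1" "fps_nth (fps_nth b 0) 0 = 1"
  shows "inverse (a * b) = inverse a * inverse b"
proof -
  have "inverse (a * b) = inverse (a * b) * (a * inverse a) * (b * inverse b)"
    using assms by (simp add: divide_fps_fps(2))
  also have "\<dots> = ((a * b) * inverse (a * b)) * (inverse a * inverse b)"
    by (simp only: mult_ac)
  also have "(a * b) * inverse (a * b) = 1"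
    using assms by (intro divide_fps_fps(2)) simp
  finally show ?thesis by simp
qed

lemma inverse_prod_qfac:
  "inverse (\<Prod>j\<in>A. qfac (n j)) = (\<Prod>j\<in>A. inverse (qfac (n j)))"
proof -
  have "inverse (1 :: zq_series) = 1"
    using divide_fps_fps(2)[of 1] by simp
  then show ?thesis
    by (induction A rule: infinite_finite_induct)
       (simp_all add: inverse_mult_zq qpoch_nth_0_0 nth_prod_qfac)
qed

lemma summand1_eq_summand2:
  assumes l: "l \<ge> 1" and b: "b \<le> l div 2"
  shows "summand1 l b n = summand2 l b (restrict (tail_sum l n) {1..l})"
proof -
  let ?N = "tail_sum l n" and ?R = "restrict (tail_sum l n) {1..l}"
  let ?Q = "qpoch (zvar * qvar) qvar (?N 1)"
  have expo: "expo2 l b ?R = expo2 l b ?N"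
    using b unfolding expo2_def by (intro arg_cong2[of _ _ _ _ "(-)"] sum.cong refl) auto
  have inv: "inv_qfac (int (?R j) - int (?R (j + 1))) = inverse (qfac (n j))" if "j \<in> {1..<l}" for j
    using that tail_sum_rec[of j l n] by (simp add: inv_qfac_def)
  have P: "(\<Prod>j\<in>{1..<l}. inv_qfac (int (?R j) - int (?R (j + 1)))) = (\<Prod>j\<in>{1..<l}. inverse (qfac (n j)))"
    by (intro prod.cong refl inv)
  have last: "inv_qfac (int (?R l)) = inverse (qfac (n l))"
    using l by (simp add: tail_sum_last inv_qfac_def)
  have "{1..l} = insert l {1..<l}" using l by auto
  then have prod: "(\<Prod>j=1..l. inverse (qfac (n j))) =
      (\<Prod>j\<in>{1..<l}. inv_qfac (int (?R j) - int (?R (j + 1)))) * inv_qfac (int (?R l))"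
    unfolding P last by (simp add: mult.commute)
  have "summand1 l b n = zvar ^ ?N 1 * qvar ^ expo2 l b ?N * qfac (?N 1)
      * inverse (?Q * (\<Prod>j=1..l. qfac (n j)))"
    unfolding summand1_def Let_def double_expo1_eq[OF b]
    by (subst divide_fps_fps(1)) (simp_all add: qpoch_nth_0_0 nth_prod_qfac)
  also have "inverse (?Q * (\<Prod>j=1..l. qfac (n j))) = inverse ?Q * (\<Prod>j=1..l. inverse (qfac (n j)))"
    by (simp add: inverse_mult_zq qpoch_nth_0_0 nth_prod_qfac inverse_prod_qfac)
  finally have s1: "summand1 l b n = zvar ^ ?N 1 * qvar ^ expo2 l b ?N * qfac (?N 1)
      * (inverse ?Q * (\<Prod>j=1..l. inverse (qfac (n j))))" .
  have div: "f / ?Q = f * inverse ?Q" for f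
    by (intro divide_fps_fps) (simp add: qpoch_nth_0_0)
  have R1: "?R 1 = ?N 1" using l by simp
  show ?thesis
    unfolding s1 prod summand2_def expo R1 div by (simp only: mult_ac)
qed

text \<open>Tail sums biject all tuples with the weakly decreasing ones; every other tuple has a
  factor \<open>1 / (q)_k\<close> with \<open>k < 0\<close> in the second sum.\<close>

lemma has_sum_summand1_iff:
  assumes l: "l \<ge> 1" and b: "b \<le> l div 2"
  shows "(summand1 l b has_sum S) (tuples l) \<longleftrightarrow> (summand2 l b has_sum S) (tuples l)"
proof -
  define D where "D = {N \<in> tuples l. \<forall>j\<in>{1..<l}. N (j + 1) \<le> N j}"
  \<comment> \<open>The inverse map takes successive differences, with \<open>N_(l+1)\<close> read
    as 0.\<close>
  define d where "d N = restrict (\<lambda>k. if k < l then N k - N (k + 1) else N k) {1..l}" for N :: "nat \<Rightarrow> nat"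
  have tail_d: "tail_sum l (d N) j = N j" if "N \<in> D" "1 \<le> j" "j \<le> l" for N j
    using that(3,2)
  proof (induction j rule: inc_induct)
    case base
    then show ?case by (simp add: tail_sum_last d_def)
  next
    case (step j)
    then have "d N j = N j - N (Suc j)" "N (Suc j) \<le> N j"
      using that(1) by (simp_all add: d_def D_def)
    then show ?case using step tail_sum_rec[of j l "d N"] by simp
  qed
  have "(summand1 l b has_sum S) (tuples l) \<longleftrightarrow> (summand2 l b has_sum S) D"
  proof (rule has_sum_reindex_bij_witness[of _ d "\<lambda>n. restrict (tail_sum l n) {1..l}"])
    fix n assume n: "n \<in> tuples l"
    show "d (restrict (tail_sum l n) {1..l}) = n"
    proof
      fix k
      show "d (restrict (tail_sum l n) {1..l}) k = n k"
      proof (cases "k \<in> {1..l}")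
        case True
        then have "k = l \<or> k < l" "k \<le> l" by auto
        then show ?thesis
          using True tail_sum_rec[of k l n] tail_sum_last[of l n] by (elim disjE) (simp_all add: d_def)
      next
        case False
        then show ?thesis using n PiE_arb[of n "{1..l}" "\<lambda>_. UNIV" k] by (auto simp: d_def tuples_def)
      qed
    qed
    show "restrict (tail_sum l n) {1..l} \<in> D"
    proof -
      have "tail_sum l n (Suc j) \<le> tail_sum l n j" if "j < l" for j
        using that tail_sum_rec[of j l n] by simp
      then show ?thesis by (simp add: D_def tuples_def)
    qed
  next
    fix N assume N: "N \<in> D"
    show "restrict (tail_sum l (d N)) {1..l} = N"
    proof
      fix k show "restrict (tail_sum l (d N)) {1..l} k = N k"
        using N tail_d[OF N, of k] PiE_arb[of N "{1..l}" "\<lambda>_. UNIV" k]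
        by (simp add: D_def tuples_def)
    qed
    show "d N \<in> tuples l" by (simp add: d_def tuples_def)
  qed (simp_all add: summand1_eq_summand2[OF l b])
  also have "\<dots> \<longleftrightarrow> (summand2 l b has_sum S) (tuples l)"
  proof (rule has_sum_cong_neutral)
    fix N assume "N \<in> tuples l - D"
    then obtain j where j: "j \<in> {1..<l}" "N j < N (j + 1)"
      by (auto simp: D_def not_le)
    then have "inv_qfac (int (N j) - int (N (j + 1))) = 0" by (simp add: inv_qfac_def)
    then have "(\<Prod>j\<in>{1..<l}. inv_qfac (int (N j) - int (N (j + 1)))) = 0"
      using j(1) by (intro prod_zero) auto
    then show "summand2 l b N = 0" by (simp add: summand2_def)
  qed (auto simp: D_def)
  finally show ?thesis .
qed

theorem theorem13:
  fixes l b :: nat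
  assumes "l \<ge> 1" and "b \<le> l div 2"
  shows "T_gf (l - b) b = T_gf b (l - b)
    \<and> (summand1 l b has_sum T_gf (l - b) b) (tuples l)
    \<and> (summand2 l b has_sum T_gf (l - b) b) (tuples l)"
proof -
  have b: "b \<le> l" "l - b \<le> l" "l - (l - b) = b" "min b (l - b) = b" "min (l - b) b = b"
    using assms(2) by auto
  \<comment> \<open>Both profiles lead to \<open>hsum\<close> at the same index
    \<open>min b (l - b) = b\<close>.\<close>
  have "T_gf (l - b) b = T_gf b (l - b)"
    using nth_T_gf_hsum_sym[OF assms(1) b(1)] nth_T_gf_hsum_sym[OF assms(1) b(2)]
    by (intro fps_ext) (simp add: hsum_sym_def b)
  moreover have "(summand2 l b has_sum T_gf (l - b) b) (tuples l)"
    using nth_T_gf_hsum_sym[OF assms(1) b(1)]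
    by (intro has_sum_summand2 assms) (simp add: hsum_sym_def b)
  ultimately show ?thesis
    using has_sum_summand1_iff[OF assms] by blast
qed

end
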